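(* For every $\hat w\in\widehat{\mathcal W}$ the Bruhat and Birkhoff cells $B\hat wB$, $B^-\hat wB^-$ and $B^-\hat wB$ are irreducible (as subspaces of $\widehat G$ with the Zariski topology).
   Context: Weyl group. $\mathbb F$ is a field of characteristic $0$. $A=(a_{ij})_{i,j\in I}$, $I=\{1,\dots,n\}$, is a symmetrizable generalized Cartan matrix of rank $l$. $H$ and $P$ are dual free $\mathbb Z$-modules of rank $2n-l$ with linearly independent subsets $\{h_1,\dots,h_n\}\subseteq H$, $\{\alpha_1,\dots,\alpha_n\}\subseteq P$ such that $\alpha_i(h_j)=a_{ji}$; $h_1,\dots,h_n$ is assumed to extend to a $\mathbb Z$-basis $h_1,\dots,h_{2n-l}$ of $H$, with dual basis $\Lambda_1,\dots,\Lambda_{2n-l}$ of $P$. Put $\mathfrak h_{\mathbb R}^*=P\otimes_{\mathbb Z}\mathbb R$, $\mathfrak h=H\otimes_{\mathbb Z}\mathbb F$. The Weyl group $\mathcal W$ is the Coxeter group with generators $\sigma_i$, $i\in I$, acting faithfully by $\sigma_i\lambda=\lambda-\lambda(h_i)\alpha_i$. $\Delta_{re}=\mathcal W\{\alpha_i\mid i\in I\}$ are the real roots; $\Delta_{re}^{\pm}$ the positive/negative ones. Tits cone and Weyl monoid. $\overline C=\{\lambda\in\mathfrak h^*_{\mathbb R}\mid\lambda(h_i)\ge0\ \forall i\in I\}$, $P^+=P\cap\overline C$; the Tits cone is $X=\mathcal W\,\overline C$, and $\mathcal R(X)$ is its set of faces. The Weyl monoid $\widehat{\mathcal W}$ is $\mathcal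 R(X)\times\mathcal W$ with product $(R,\sigma)(S,\tau)=(R\cap\sigma S,\sigma\tau)$ modulo the congruence $(R,\sigma)\sim(R',\sigma')$ iff $R=R'$ and $\sigma'\sigma^{-1}$ fixes $R$ pointwise. The class of $(R,\sigma)$ is written $\varepsilon(R)\sigma$; $\sigma\in\mathcal W$ is identified with $\varepsilon(X)\sigma$. The monoid $\widehat G$. $\mathfrak g$ is the Kac-Moody algebra over $\mathbb F$ of $A$, generated by $\mathfrak h$ and $e_i,f_i$ $(i\in I)$, with root spaces $\mathfrak g_\alpha$; its Chevalley involution $*$ is the involutive anti-automorphism with $e_i^*=f_i$, $f_i^*=e_i$, $h^*=h$. For $\Lambda\in P^+$, $L(\Lambda)$ is the irreducible highest weight $\mathfrak g$-module with highest weight $\Lambda$, with a fixed nondegenerate symmetric bilinear form $\langle\langle\,\mid\,\rangle\rangle$ that is contravariant ($\langle\langle v\mid xw\rangle\rangle=\langle\langle x^*v\mid w\rangle\rangle$ for $x\in\mathfrak g$). All weights of $L(\Lambda)$ lie in $X\cap P$. $\widehat G$ is the submonoid of $\mathrm{End}\big(\bigoplus_{\Lambda\in P^+}L(\Lambda)\big)$ generated by: $t_h(s)$ ($h\in H$, $s\in\mathbb F^\times$), acting on a vector of weight $\lambda$ by $s^{\lambda(h)}$; $\exp(x)$ ($x\in\mathfrak g_\alpha$, $\alpha\in\Delta_{re}$); and $e(R)$ ($R\in\mathcal R(X)$), acting on a vector of weight $\lambda$ as the identity if $\lambda\in R$ and as $0$ if $\lambda\in X\setminus R$. The coordinate ring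 $\mathbb F[\widehat G]$ is the algebra of functions on $\widehat G$ spanned by the matrix coefficients $f_{vw}(x)=\langle\langle v\mid xw\rangle\rangle$, $v,w\in L(\Lambda)$, $\Lambda\in P^+$. The Zariski topology on $\widehat G$ has as closed sets the zero sets of functions of $\mathbb F[\widehat G]$. Subgroups and cells. $T$ is the group generated by the $t_h(s)$; $U_\alpha=\exp(\mathfrak g_\alpha)$; $U^\pm$ is generated by $U_\alpha$, $\alpha\in\Delta_{re}^\pm$; $B^\pm=TU^\pm$; $B=B^+$. $N$ is generated by $T$ and $n_i=\exp(e_i)\exp(-f_i)\exp(e_i)$, $i\in I$; $N/T\cong\mathcal W$ via $n_iT\leftrightarrow\sigma_i$, and $n_\sigma$ denotes an element of $N$ representing $\sigma$. $\widehat N=\bigcup_{R\in\mathcal R(X)}Ne(R)$, and $\widehat{\mathcal W}\cong\widehat N/T$ via $\sigma\varepsilon(R)\mapsto n_\sigma e(R)T$. For $\hat w\in\widehat{\mathcal W}$, $B^{\epsilon}\hat wB^{\delta}$ means $B^{\epsilon}\hat nB^{\delta}$ with $\hat n\in\widehat N$ any element representing $\hat w$ ($\epsilon,\delta\in\{+,-\}$). *)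

theory Defs
  imports "HOL-Analysis.Analysis" "HOL-Library.Function_Algebras"
begin

text \<open>Functionals with values in \<open>\<real>\<close> form a real vector space pointwise; this makes the library's
  notion of a face available for subsets of \<open>'h \<Rightarrow> real\<close>.\<close>

instantiation "fun" :: (type, real_vector) real_vector
begin

definition "scaleR_fun (c::real) f = (\<lambda>x. c *\<^sub>R f x)"

instance
  by standard (simp_all add: scaleR_fun_def fun_eq_iff scaleR_add_right scaleR_add_left)

end

text \<open>Subgroup of the group of bijections generated by \<open>S\<close>, and submonoid of the monoid of maps
  generated by \<open>S\<close>.\<close>

inductive_set group_gen :: "('a \<Rightarrow> 'a) set \<Rightarrow> ('a \<Rightarrow> 'a) set" for S where
  "id \<in> group_gen S"
| "x \<in> S \<Longrightarrow> x \<in> group_gen S"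
| "x \<in> group_gen S \<Longrightarrow> y \<in> group_gen S \<Longrightarrow> x \<circ> y \<in> group_gen S"
| "x \<in> group_gen S \<Longrightarrow> inv x \<in> group_gen S"

inductive_set monoid_gen :: "('a \<Rightarrow> 'a) set \<Rightarrow> ('a \<Rightarrow> 'a) set" for S where
  "id \<in> monoid_gen S"
| "x \<in> S \<Longrightarrow> x \<in> monoid_gen S"
| "x \<in> monoid_gen S \<Longrightarrow> y \<in> monoid_gen S \<Longrightarrow> x \<circ> y \<in> monoid_gen S"

locale lie_algebra = vector_space scale
  for scale :: "'k::field \<Rightarrow> 'g::ab_group_add \<Rightarrow> 'g" +
  fixes bracket :: "'g \<Rightarrow> 'g \<Rightarrow> 'g"
  assumes bracket_add_left: "bracket (x + y) z = bracket x z + bracket y z"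
    and bracket_add_right: "bracket x (y + z) = bracket x y + bracket x z"
    and bracket_scale_left: "bracket (scale c x) y = scale c (bracket x y)"
    and bracket_scale_right: "bracket x (scale c y) = scale c (bracket x y)"
    and bracket_self: "bracket x x = 0"
    and jacobi: "bracket x (bracket y z) + bracket y (bracket z x) + bracket z (bracket x y) = 0"

text \<open>The index set \<open>I\<close> is the finite type \<open>'n\<close>, the group \<open>H\<close> is the type \<open>'h\<close>, the Kac-Moody
  algebra is the type \<open>'g\<close>, and the module \<open>\<Oplus>\<^sub>\<Lambda> L(\<Lambda>)\<close> is the type \<open>'v\<close>, with the \<open>L(\<Lambda>)\<close> as subsets.
  Elements of \<open>P\<close> are additive maps \<open>'h \<Rightarrow> int\<close>. The map \<open>to_g\<close> sends \<open>x \<in> H\<close> to the element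
  \<open>x \<otimes> 1\<close> of the Cartan subalgebra \<open>H \<otimes> \<bbbF>\<close>.\<close>

record ('k, 'n::finite, 'h, 'g, 'v) km_data =
  cartan :: "int ^ 'n ^ 'n"
  zscale :: "int \<Rightarrow> 'h \<Rightarrow> 'h"
  coroot :: "'n \<Rightarrow> 'h"
  simple_root :: "'n \<Rightarrow> 'h \<Rightarrow> int"
  gscale :: "'k \<Rightarrow> 'g \<Rightarrow> 'g"
  bracket :: "'g \<Rightarrow> 'g \<Rightarrow> 'g"
  to_g :: "'h \<Rightarrow> 'g"
  chev_e :: "'n \<Rightarrow> 'g"
  chev_f :: "'n \<Rightarrow> 'g"
  star :: "'g \<Rightarrow> 'g"
  vscale :: "'k \<Rightarrow> 'v \<Rightarrow> 'v"
  act :: "'g \<Rightarrow> 'v \<Rightarrow> 'v"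
  L :: "('h \<Rightarrow> int) \<Rightarrow> 'v set"
  form :: "('h \<Rightarrow> int) \<Rightarrow> 'v \<Rightarrow> 'v \<Rightarrow> 'k"


subsection \<open>Root datum, Weyl group, Tits cone\<close>

definition gen_cartan_matrix :: "int ^ 'n ^ 'n \<Rightarrow> bool" where
  "gen_cartan_matrix A \<longleftrightarrow>
     (\<forall>i. A $ i $ i = 2) \<and>
     (\<forall>i j. i \<noteq> j \<longrightarrow> A $ i $ j \<le> 0) \<and>
     (\<forall>i j. A $ i $ j = 0 \<longrightarrow> A $ j $ i = 0)"

definition symmetrizable :: "int ^ 'n ^ 'n \<Rightarrow> bool" where
  "symmetrizable A \<longleftrightarrow>
     (\<exists>d :: 'n \<Rightarrow> rat. (\<forall>i. d i \<noteq> 0) \<and>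
        (\<forall>i j. d i * of_int (A $ i $ j) = d j * of_int (A $ j $ i)))"

definition weight_lattice ::
  "('k, 'n::finite, 'h::ab_group_add, 'g, 'v) km_data \<Rightarrow> ('h \<Rightarrow> int) set" where
  "weight_lattice D = {\<mu>. module_hom (zscale D) (*) \<mu>}"

definition root_datum :: "('k, 'n::finite, 'h::ab_group_add, 'g, 'v) km_data \<Rightarrow> bool" where
  "root_datum D \<longleftrightarrow>
     gen_cartan_matrix (cartan D) \<and> symmetrizable (cartan D) \<and>
     module (zscale D) \<and>
     inj (coroot D) \<and>
     (\<exists>\<B>. range (coroot D) \<subseteq> \<B> \<and>
        \<not> module.dependent (zscale D) \<B> \<and> module.span (zscale D) \<B> = UNIV \<and>
        card \<B> = 2 * CARD('n) - rank (\<chi> i j. rat_of_int (cartan D $ i $ j))) \<and>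
     range (simple_root D) \<subseteq> weight_lattice D \<and>
     inj (simple_root D) \<and>
     \<not> module.dependent (\<lambda>(c::int) \<mu> x. c * \<mu> x) (range (simple_root D)) \<and>
     (\<forall>i j. simple_root D i (coroot D j) = cartan D $ j $ i)"

definition to_real :: "('h \<Rightarrow> int) \<Rightarrow> 'h \<Rightarrow> real" where
  "to_real \<mu> = (\<lambda>x. real_of_int (\<mu> x))"

definition reflection ::
  "('k, 'n::finite, 'h, 'g, 'v) km_data \<Rightarrow> 'n \<Rightarrow> ('h \<Rightarrow> real) \<Rightarrow> ('h \<Rightarrow> real)" where
  "reflection D i \<mu> = \<mu> - \<mu> (coroot D i) *\<^sub>R to_real (simple_root D i)"

text \<open>The Weyl group in its faithful action. It acts on all of \<open>'h \<Rightarrow> real\<close>, not just on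
  the subspace of additive maps; no information is added, since a reflection depends on \<open>\<mu>\<close> only
  through the values of \<open>\<mu>\<close> at the coroots, and these are attained by an additive map.\<close>

definition weyl_group ::
  "('k, 'n::finite, 'h, 'g, 'v) km_data \<Rightarrow> (('h \<Rightarrow> real) \<Rightarrow> ('h \<Rightarrow> real)) set" where
  "weyl_group D = group_gen (range (reflection D))"

definition real_roots ::
  "('k, 'n::finite, 'h, 'g, 'v) km_data \<Rightarrow> ('h \<Rightarrow> int) set" where
  "real_roots D = {\<beta>. \<exists>\<sigma>\<in>weyl_group D. \<exists>i. to_real \<beta> = \<sigma> (to_real (simple_root D i))}"

definition pos_real_roots ::
  "('k, 'n::finite, 'h, 'g, 'v) km_data \<Rightarrow> ('h \<Rightarrow> int) set" where
  "pos_real_roots D =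
     {\<beta>\<in>real_roots D. \<exists>c :: 'n \<Rightarrow> nat. \<beta> = (\<lambda>x. \<Sum>i\<in>UNIV. int (c i) * simple_root D i x)}"

definition neg_real_roots ::
  "('k, 'n::finite, 'h, 'g, 'v) km_data \<Rightarrow> ('h \<Rightarrow> int) set" where
  "neg_real_roots D =
     {\<beta>\<in>real_roots D. \<exists>c :: 'n \<Rightarrow> nat. \<beta> = (\<lambda>x. - (\<Sum>i\<in>UNIV. int (c i) * simple_root D i x))}"

text \<open>Since \<open>H\<close> is free of finite rank, \<open>P \<otimes> \<real>\<close> is the space of additive maps \<open>H \<rightarrow> \<real>\<close>.\<close>

definition fundamental_chamber ::
  "('k, 'n::finite, 'h::ab_group_add, 'g, 'v) km_data \<Rightarrow> ('h \<Rightarrow> real) set" where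
  "fundamental_chamber D = {\<mu>. Modules.additive \<mu> \<and> (\<forall>i. 0 \<le> \<mu> (coroot D i))}"

definition dominant_weights ::
  "('k, 'n::finite, 'h::ab_group_add, 'g, 'v) km_data \<Rightarrow> ('h \<Rightarrow> int) set" where
  "dominant_weights D = {\<mu>\<in>weight_lattice D. to_real \<mu> \<in> fundamental_chamber D}"

definition tits_cone ::
  "('k, 'n::finite, 'h::ab_group_add, 'g, 'v) km_data \<Rightarrow> ('h \<Rightarrow> real) set" where
  "tits_cone D = (\<Union>\<sigma>\<in>weyl_group D. \<sigma> ` fundamental_chamber D)"

text \<open>The library admits the empty set as a face; faces of a convex cone are nonempty.\<close>

definition tits_faces ::
  "('k, 'n::finite, 'h::ab_group_add, 'g, 'v) km_data \<Rightarrow> ('h \<Rightarrow> real) set set" where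
  "tits_faces D = {R. R face_of tits_cone D \<and> R \<noteq> {}}"


subsection \<open>The Weyl monoid\<close>

type_synonym 'h weyl_pair = "('h \<Rightarrow> real) set \<times> (('h \<Rightarrow> real) \<Rightarrow> ('h \<Rightarrow> real))"

definition weyl_monoid_rel ::
  "('k, 'n::finite, 'h::ab_group_add, 'g, 'v) km_data \<Rightarrow> ('h weyl_pair \<times> 'h weyl_pair) set" where
  "weyl_monoid_rel D =
     {((R, \<sigma>), (R', \<sigma>')). R \<in> tits_faces D \<and> R' \<in> tits_faces D \<and>
        \<sigma> \<in> weyl_group D \<and> \<sigma>' \<in> weyl_group D \<and> R = R' \<and> (\<forall>\<mu>\<in>R. (\<sigma>' \<circ> inv \<sigma>) \<mu> = \<mu>)}"

definition weyl_monoid ::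
  "('k, 'n::finite, 'h::ab_group_add, 'g, 'v) km_data \<Rightarrow> 'h weyl_pair set set" where
  "weyl_monoid D = (tits_faces D \<times> weyl_group D) // weyl_monoid_rel D"

fun weyl_pair_mult :: "'h weyl_pair \<Rightarrow> 'h weyl_pair \<Rightarrow> 'h weyl_pair" where
  "weyl_pair_mult (R, \<sigma>) (S, \<tau>) = (R \<inter> \<sigma> ` S, \<sigma> \<circ> \<tau>)"

definition weyl_monoid_mult ::
  "('k, 'n::finite, 'h::ab_group_add, 'g, 'v) km_data \<Rightarrow>
     'h weyl_pair set \<Rightarrow> 'h weyl_pair set \<Rightarrow> 'h weyl_pair set" where
  "weyl_monoid_mult D a b = (\<Union>p\<in>a. \<Union>q\<in>b. weyl_monoid_rel D `` {weyl_pair_mult p q})"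

definition weyl_idem ::
  "('k, 'n::finite, 'h::ab_group_add, 'g, 'v) km_data \<Rightarrow>
     ('h \<Rightarrow> real) set \<Rightarrow> 'h weyl_pair set" where
  "weyl_idem D R = weyl_monoid_rel D `` {(R, id)}"

definition weyl_unit ::
  "('k, 'n::finite, 'h::ab_group_add, 'g, 'v) km_data \<Rightarrow>
     (('h \<Rightarrow> real) \<Rightarrow> ('h \<Rightarrow> real)) \<Rightarrow> 'h weyl_pair set" where
  "weyl_unit D \<sigma> = weyl_monoid_rel D `` {(tits_cone D, \<sigma>)}"


subsection \<open>The Kac-Moody algebra\<close>

text \<open>The Kac-Moody algebra is presented by generators and relations: formal Lie expressions in
  the generators, modulo the least congruence containing the Lie algebra laws, the relations
  making \<open>x \<mapsto> GenH x\<close> a homomorphism from \<open>H\<close> onto commuting elements, the Chevalley relations,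
  and the Serre relations.\<close>

datatype ('k, 'n, 'h) lie_term =
    GenH 'h | GenE 'n | GenF 'n
  | Zero
  | Add "('k, 'n, 'h) lie_term" "('k, 'n, 'h) lie_term"
  | Scale 'k "('k, 'n, 'h) lie_term"
  | Brk "('k, 'n, 'h) lie_term" "('k, 'n, 'h) lie_term"

inductive km_eq ::
  "('k::field_char_0, 'n::finite, 'h::ab_group_add, 'g, 'v) km_data \<Rightarrow>
     ('k, 'n, 'h) lie_term \<Rightarrow> ('k, 'n, 'h) lie_term \<Rightarrow> bool" for D where
  refl: "km_eq D s s"
| sym: "km_eq D s t \<Longrightarrow> km_eq D t s"
| trans: "km_eq D s t \<Longrightarrow> km_eq D t u \<Longrightarrow> km_eq D s u"
| add_cong: "km_eq D s s' \<Longrightarrow> km_eq D t t' \<Longrightarrow> km_eq D (Add s t) (Add s' t')"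
| scale_cong: "km_eq D s s' \<Longrightarrow> km_eq D (Scale c s) (Scale c s')"
| brk_cong: "km_eq D s s' \<Longrightarrow> km_eq D t t' \<Longrightarrow> km_eq D (Brk s t) (Brk s' t')"
| add_assoc: "km_eq D (Add (Add s t) u) (Add s (Add t u))"
| add_commute: "km_eq D (Add s t) (Add t s)"
| add_zero: "km_eq D (Add Zero s) s"
| add_neg: "km_eq D (Add s (Scale (-1) s)) Zero"
| scale_one: "km_eq D (Scale 1 s) s"
| scale_scale: "km_eq D (Scale a (Scale b s)) (Scale (a * b) s)"
| scale_add_right: "km_eq D (Scale a (Add s t)) (Add (Scale a s) (Scale a t))"
| scale_add_left: "km_eq D (Scale (a + b) s) (Add (Scale a s) (Scale b s))"
| brk_add_left: "km_eq D (Brk (Add s t) u) (Add (Brk s u) (Brk t u))"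
| brk_add_right: "km_eq D (Brk s (Add t u)) (Add (Brk s t) (Brk s u))"
| brk_scale_left: "km_eq D (Brk (Scale a s) t) (Scale a (Brk s t))"
| brk_scale_right: "km_eq D (Brk s (Scale a t)) (Scale a (Brk s t))"
| brk_self: "km_eq D (Brk s s) Zero"
| jacobi: "km_eq D (Add (Brk s (Brk t u)) (Add (Brk t (Brk u s)) (Brk u (Brk s t)))) Zero"
| h_add: "km_eq D (GenH (x + y)) (Add (GenH x) (GenH y))"
| h_h: "km_eq D (Brk (GenH x) (GenH y)) Zero"
| h_e: "km_eq D (Brk (GenH x) (GenE i)) (Scale (of_int (simple_root D i x)) (GenE i))"
| h_f: "km_eq D (Brk (GenH x) (GenF i)) (Scale (- of_int (simple_root D i x)) (GenF i))"
| e_f: "km_eq D (Brk (GenE i) (GenF j)) (if i = j then GenH (coroot D i) else Zero)"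
| serre_e: "i \<noteq> j \<Longrightarrow>
    km_eq D ((Brk (GenE i) ^^ nat (1 - cartan D $ i $ j)) (GenE j)) Zero"
| serre_f: "i \<noteq> j \<Longrightarrow>
    km_eq D ((Brk (GenF i) ^^ nat (1 - cartan D $ i $ j)) (GenF j)) Zero"

primrec lie_eval ::
  "('k, 'n::finite, 'h, 'g::ab_group_add, 'v) km_data \<Rightarrow> ('k, 'n, 'h) lie_term \<Rightarrow> 'g" where
  "lie_eval D (GenH x) = to_g D x"
| "lie_eval D (GenE i) = chev_e D i"
| "lie_eval D (GenF i) = chev_f D i"
| "lie_eval D Zero = 0"
| "lie_eval D (Add s t) = lie_eval D s + lie_eval D t"
| "lie_eval D (Scale c s) = gscale D c (lie_eval D s)"
| "lie_eval D (Brk s t) = bracket D (lie_eval D s) (lie_eval D t)"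

text \<open>The evaluation of terms identifies the term algebra modulo \<open>km_eq\<close> with \<open>'g\<close>.\<close>

definition kac_moody_algebra ::
  "('k::field_char_0, 'n::finite, 'h::ab_group_add, 'g::ab_group_add, 'v) km_data \<Rightarrow> bool" where
  "kac_moody_algebra D \<longleftrightarrow>
     lie_algebra (gscale D) (bracket D) \<and>
     surj (lie_eval D) \<and>
     (\<forall>s t. lie_eval D s = lie_eval D t \<longleftrightarrow> km_eq D s t)"

definition chevalley_involution ::
  "('k::field_char_0, 'n::finite, 'h::ab_group_add, 'g::ab_group_add, 'v) km_data \<Rightarrow> bool" where
  "chevalley_involution D \<longleftrightarrow>
     Vector_Spaces.linear (gscale D) (gscale D) (star D) \<and>
     (\<forall>x y. star D (bracket D x y) = bracket D (star D y) (star D x)) \<and>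
     (\<forall>x. star D (star D x) = x) \<and>
     (\<forall>i. star D (chev_e D i) = chev_f D i) \<and>
     (\<forall>i. star D (chev_f D i) = chev_e D i) \<and>
     (\<forall>x. star D (to_g D x) = to_g D x)"

definition root_space ::
  "('k::field_char_0, 'n::finite, 'h, 'g, 'v) km_data \<Rightarrow> ('h \<Rightarrow> int) \<Rightarrow> 'g set" where
  "root_space D \<alpha> = {y. \<forall>x. bracket D (to_g D x) y = gscale D (of_int (\<alpha> x)) y}"


subsection \<open>Highest weight modules\<close>

definition lie_module ::
  "('k::field_char_0, 'n::finite, 'h, 'g::ab_group_add, 'v::ab_group_add) km_data \<Rightarrow> bool" where
  "lie_module D \<longleftrightarrow>
     vector_space (vscale D) \<and>
     (\<forall>x. Vector_Spaces.linear (vscale D) (vscale D) (act D x)) \<and>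
     (\<forall>x y v. act D (x + y) v = act D x v + act D y v) \<and>
     (\<forall>c x v. act D (gscale D c x) v = vscale D c (act D x v)) \<and>
     (\<forall>x y v. act D (bracket D x y) v = act D x (act D y v) - act D y (act D x v))"

definition submodule ::
  "('k::field_char_0, 'n::finite, 'h, 'g, 'v::ab_group_add) km_data \<Rightarrow> 'v set \<Rightarrow> bool" where
  "submodule D S \<longleftrightarrow> module.subspace (vscale D) S \<and> (\<forall>x. \<forall>v\<in>S. act D x v \<in> S)"

definition weight_space ::
  "('k::field_char_0, 'n::finite, 'h, 'g, 'v) km_data \<Rightarrow> ('h \<Rightarrow> int) \<Rightarrow> 'v set" where
  "weight_space D \<mu> = {v. \<forall>x. act D (to_g D x) v = vscale D (of_int (\<mu> x)) v}"

definition irreducible_highest_weight ::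
  "('k::field_char_0, 'n::finite, 'h, 'g, 'v::ab_group_add) km_data \<Rightarrow>
     ('h \<Rightarrow> int) \<Rightarrow> 'v set \<Rightarrow> bool" where
  "irreducible_highest_weight D \<Lambda> M \<longleftrightarrow>
     submodule D M \<and>
     (\<exists>v\<in>M. v \<noteq> 0 \<and> v \<in> weight_space D \<Lambda> \<and> (\<forall>i. act D (chev_e D i) v = 0) \<and>
        (\<forall>S. submodule D S \<and> v \<in> S \<longrightarrow> M \<subseteq> S)) \<and>
     (\<forall>S. submodule D S \<and> S \<subseteq> M \<longrightarrow> S = {0} \<or> S = M)"

definition internal_direct_sum ::
  "('k::field_char_0, 'n::finite, 'h::ab_group_add, 'g, 'v::ab_group_add) km_data \<Rightarrow> bool" where
  "internal_direct_sum D \<longleftrightarrow>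
     module.span (vscale D) (\<Union>\<Lambda>\<in>dominant_weights D. L D \<Lambda>) = UNIV \<and>
     (\<forall>S u. finite S \<and> S \<subseteq> dominant_weights D \<and> (\<forall>\<Lambda>\<in>S. u \<Lambda> \<in> L D \<Lambda>) \<and> (\<Sum>\<Lambda>\<in>S. u \<Lambda>) = 0
        \<longrightarrow> (\<forall>\<Lambda>\<in>S. u \<Lambda> = 0))"

definition contravariant_form ::
  "('k::field_char_0, 'n::finite, 'h, 'g, 'v::ab_group_add) km_data \<Rightarrow> ('h \<Rightarrow> int) \<Rightarrow> bool" where
  "contravariant_form D \<Lambda> \<longleftrightarrow>
     (\<forall>u\<in>L D \<Lambda>. \<forall>v\<in>L D \<Lambda>. \<forall>w\<in>L D \<Lambda>.
        form D \<Lambda> (u + v) w = form D \<Lambda> u w + form D \<Lambda> v w) \<and>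
     (\<forall>c. \<forall>v\<in>L D \<Lambda>. \<forall>w\<in>L D \<Lambda>. form D \<Lambda> (vscale D c v) w = c * form D \<Lambda> v w) \<and>
     (\<forall>v\<in>L D \<Lambda>. \<forall>w\<in>L D \<Lambda>. form D \<Lambda> v w = form D \<Lambda> w v) \<and>
     (\<forall>v\<in>L D \<Lambda>. (\<forall>w\<in>L D \<Lambda>. form D \<Lambda> v w = 0) \<longrightarrow> v = 0) \<and>
     (\<forall>x. \<forall>v\<in>L D \<Lambda>. \<forall>w\<in>L D \<Lambda>. form D \<Lambda> v (act D x w) = form D \<Lambda> (act D (star D x) v) w)"

definition kac_moody_setting ::
  "('k::field_char_0, 'n::finite, 'h::ab_group_add, 'g::ab_group_add, 'v::ab_group_add) km_data \<Rightarrow>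
     bool" where
  "kac_moody_setting D \<longleftrightarrow>
     root_datum D \<and> kac_moody_algebra D \<and> chevalley_involution D \<and> lie_module D \<and>
     (\<forall>\<Lambda>\<in>dominant_weights D. irreducible_highest_weight D \<Lambda> (L D \<Lambda>) \<and> contravariant_form D \<Lambda>) \<and>
     internal_direct_sum D"


subsection \<open>The monoid \<open>\<hat>G\<close>, its coordinate ring and Zariski topology\<close>

definition torus_elt ::
  "('k::field_char_0, 'n::finite, 'h::ab_group_add, 'g, 'v::ab_group_add) km_data \<Rightarrow>
     'h \<Rightarrow> 'k \<Rightarrow> 'v \<Rightarrow> 'v" where
  "torus_elt D x s = (THE \<phi>. Vector_Spaces.linear (vscale D) (vscale D) \<phi> \<and>
     (\<forall>\<mu>\<in>weight_lattice D. \<forall>v\<in>weight_space D \<mu>. \<phi> v = vscale D (s powi \<mu> x) v))"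

text \<open>All weights lie in the Tits cone, so that a weight outside \<open>R\<close> lies in \<open>X \<setminus> R\<close>.\<close>

definition face_idem ::
  "('k::field_char_0, 'n::finite, 'h::ab_group_add, 'g, 'v::ab_group_add) km_data \<Rightarrow>
     ('h \<Rightarrow> real) set \<Rightarrow> 'v \<Rightarrow> 'v" where
  "face_idem D R = (THE \<phi>. Vector_Spaces.linear (vscale D) (vscale D) \<phi> \<and>
     (\<forall>\<mu>\<in>weight_lattice D. \<forall>v\<in>weight_space D \<mu>. \<phi> v = (if to_real \<mu> \<in> R then v else 0)))"

text \<open>Only used for locally nilpotent \<open>x\<close>, where the sum is finite and contains all nonzero terms of
  the exponential series.\<close>

definition exp_op ::
  "('k::field_char_0, 'n::finite, 'h, 'g, 'v::ab_group_add) km_data \<Rightarrow> 'g \<Rightarrow> 'v \<Rightarrow> 'v" where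
  "exp_op D x v =
     (\<Sum>k\<in>{k. (act D x ^^ k) v \<noteq> 0}. vscale D (1 / fact k) ((act D x ^^ k) v))"

definition torus_gens ::
  "('k::field_char_0, 'n::finite, 'h::ab_group_add, 'g, 'v::ab_group_add) km_data \<Rightarrow>
     ('v \<Rightarrow> 'v) set" where
  "torus_gens D = {torus_elt D x s | x s. s \<noteq> 0}"

definition root_gens ::
  "('k::field_char_0, 'n::finite, 'h, 'g, 'v::ab_group_add) km_data \<Rightarrow>
     ('h \<Rightarrow> int) set \<Rightarrow> ('v \<Rightarrow> 'v) set" where
  "root_gens D \<Phi> = (\<Union>\<alpha>\<in>\<Phi>. exp_op D ` root_space D \<alpha>)"

definition G_hat ::
  "('k::field_char_0, 'n::finite, 'h::ab_group_add, 'g, 'v::ab_group_add) km_data \<Rightarrow>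
     ('v \<Rightarrow> 'v) set" where
  "G_hat D = monoid_gen
     (torus_gens D \<union> root_gens D (real_roots D) \<union> face_idem D ` tits_faces D)"

definition matrix_coeff ::
  "('k, 'n::finite, 'h, 'g, 'v) km_data \<Rightarrow>
     ('h \<Rightarrow> int) \<Rightarrow> 'v \<Rightarrow> 'v \<Rightarrow> ('v \<Rightarrow> 'v) \<Rightarrow> 'k" where
  "matrix_coeff D \<Lambda> v w = (\<lambda>x. form D \<Lambda> v (x w))"

text \<open>Functions on \<open>\<hat>G\<close> are represented by functions on all maps \<open>'v \<Rightarrow> 'v\<close>, of which only the
  values on \<open>\<hat>G\<close> are ever used.\<close>

definition coord_ring ::
  "('k::field_char_0, 'n::finite, 'h::ab_group_add, 'g, 'v) km_data \<Rightarrow>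
     (('v \<Rightarrow> 'v) \<Rightarrow> 'k) set" where
  "coord_ring D = module.span (\<lambda>c f x. c * f x)
     {matrix_coeff D \<Lambda> v w | \<Lambda> v w. \<Lambda> \<in> dominant_weights D \<and> v \<in> L D \<Lambda> \<and> w \<in> L D \<Lambda>}"

definition zariski_closed ::
  "('k::field_char_0, 'n::finite, 'h::ab_group_add, 'g, 'v::ab_group_add) km_data \<Rightarrow>
     ('v \<Rightarrow> 'v) set \<Rightarrow> bool" where
  "zariski_closed D C \<longleftrightarrow>
     (\<exists>F\<subseteq>coord_ring D. C = {x\<in>G_hat D. \<forall>f\<in>F. f x = 0})"

text \<open>\<open>Y\<close> with the subspace topology is irreducible: it is nonempty and not the union of two
  proper subsets that are closed in \<open>Y\<close>.\<close>

definition zariski_irreducible ::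
  "('k::field_char_0, 'n::finite, 'h::ab_group_add, 'g, 'v::ab_group_add) km_data \<Rightarrow>
     ('v \<Rightarrow> 'v) set \<Rightarrow> bool" where
  "zariski_irreducible D Y \<longleftrightarrow>
     Y \<subseteq> G_hat D \<and> Y \<noteq> {} \<and>
     (\<forall>C1 C2. zariski_closed D C1 \<and> zariski_closed D C2 \<and> Y = (Y \<inter> C1) \<union> (Y \<inter> C2)
        \<longrightarrow> Y \<inter> C1 = Y \<or> Y \<inter> C2 = Y)"


subsection \<open>Subgroups and cells\<close>

definition torus ::
  "('k::field_char_0, 'n::finite, 'h::ab_group_add, 'g, 'v::ab_group_add) km_data \<Rightarrow>
     ('v \<Rightarrow> 'v) set" where
  "torus D = group_gen (torus_gens D)"

definition U_pos ::
  "('k::field_char_0, 'n::finite, 'h, 'g, 'v::ab_group_add) km_data \<Rightarrow> ('v \<Rightarrow> 'v) set" where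
  "U_pos D = group_gen (root_gens D (pos_real_roots D))"

definition U_neg ::
  "('k::field_char_0, 'n::finite, 'h, 'g, 'v::ab_group_add) km_data \<Rightarrow> ('v \<Rightarrow> 'v) set" where
  "U_neg D = group_gen (root_gens D (neg_real_roots D))"

definition B_pos ::
  "('k::field_char_0, 'n::finite, 'h::ab_group_add, 'g, 'v::ab_group_add) km_data \<Rightarrow>
     ('v \<Rightarrow> 'v) set" where
  "B_pos D = {t \<circ> u | t u. t \<in> torus D \<and> u \<in> U_pos D}"

definition B_neg ::
  "('k::field_char_0, 'n::finite, 'h::ab_group_add, 'g, 'v::ab_group_add) km_data \<Rightarrow>
     ('v \<Rightarrow> 'v) set" where
  "B_neg D = {t \<circ> u | t u. t \<in> torus D \<and> u \<in> U_neg D}"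

definition n_elt ::
  "('k::field_char_0, 'n::finite, 'h, 'g::ab_group_add, 'v::ab_group_add) km_data \<Rightarrow>
     'n \<Rightarrow> 'v \<Rightarrow> 'v" where
  "n_elt D i = exp_op D (chev_e D i) \<circ> exp_op D (- chev_f D i) \<circ> exp_op D (chev_e D i)"

text \<open>The graph of the homomorphism \<open>N \<rightarrow> N/T \<cong> W\<close>: the subgroup of \<open>N \<times> W\<close> generated by the
  pairs \<open>(t, 1)\<close> and \<open>(n\<^sub>i, \<sigma>\<^sub>i)\<close>. Thus \<open>(n, \<sigma>) \<in> N_graph D\<close> means that \<open>n \<in> N\<close> represents \<open>\<sigma>\<close>.\<close>

inductive_set N_graph ::
  "('k::field_char_0, 'n::finite, 'h::ab_group_add, 'g::ab_group_add, 'v::ab_group_add) km_data \<Rightarrow>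
     (('v \<Rightarrow> 'v) \<times> (('h \<Rightarrow> real) \<Rightarrow> ('h \<Rightarrow> real))) set" for D where
  "t \<in> torus D \<Longrightarrow> (t, id) \<in> N_graph D"
| "(n_elt D i, reflection D i) \<in> N_graph D"
| "(n, \<sigma>) \<in> N_graph D \<Longrightarrow> (n', \<sigma>') \<in> N_graph D \<Longrightarrow> (n \<circ> n', \<sigma> \<circ> \<sigma>') \<in> N_graph D"
| "(n, \<sigma>) \<in> N_graph D \<Longrightarrow> (inv n, inv \<sigma>) \<in> N_graph D"

text \<open>The element \<open>n\<close> of \<open>\<hat>N\<close> represents \<open>w\<close> if \<open>w = \<sigma> \<epsilon>(R)\<close> and \<open>n\<close> lies in the coset
  \<open>n\<^sub>\<sigma> e(R) T\<close>.\<close>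

definition represents ::
  "('k::field_char_0, 'n::finite, 'h::ab_group_add, 'g::ab_group_add, 'v::ab_group_add) km_data \<Rightarrow>
     ('v \<Rightarrow> 'v) \<Rightarrow> 'h weyl_pair set \<Rightarrow> bool" where
  "represents D n w \<longleftrightarrow>
     (\<exists>\<sigma>\<in>weyl_group D. \<exists>R\<in>tits_faces D. \<exists>n\<^sub>\<sigma>. \<exists>t\<in>torus D.
        w = weyl_monoid_mult D (weyl_unit D \<sigma>) (weyl_idem D R) \<and>
        (n\<^sub>\<sigma>, \<sigma>) \<in> N_graph D \<and> n = n\<^sub>\<sigma> \<circ> face_idem D R \<circ> t)"

definition double_coset :: "('v \<Rightarrow> 'v) set \<Rightarrow> ('v \<Rightarrow> 'v) \<Rightarrow> ('v \<Rightarrow> 'v) set \<Rightarrow> ('v \<Rightarrow> 'v) set" where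
  "double_coset B1 n B2 = {b \<circ> n \<circ> b' | b b'. b \<in> B1 \<and> b' \<in> B2}"

end

theory Submission
  imports Defs "HOL-Computational_Algebra.Polynomial"
begin

text \<open>
  Any two points of a cell \<open>B\<^sub>1 n B\<^sub>2\<close> lie on a rational curve inside the cell, and this forces
  irreducibility. Suppose the cell is covered by two closed sets and neither contains it. Then there
  are functions \<open>f\<^sub>1, f\<^sub>2\<close> of the coordinate ring, each vanishing on one of the closed sets, and
  points \<open>y\<^sub>1, y\<^sub>2\<close> of the cell with \<open>f\<^sub>1(y\<^sub>1) \<noteq> 0\<close> and \<open>f\<^sub>2(y\<^sub>2) \<noteq> 0\<close>. Along a curve from \<open>y\<^sub>1\<close> to \<open>y\<^sub>2\<close>
  both functions become quotients of polynomials in one parameter that are not identically zero,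
  so each has finitely many zeros. As the field is infinite, some point of the curve is a zero of
  neither function, and that point lies in neither closed set (\<open>zariski_irreducibleI\<close>).

  To obtain the curves, write the cell as the product \<open>T U\<^sub>1 n T U\<^sub>2\<close>. Each of \<open>T, U\<^sub>1, U\<^sub>2\<close> is generated by
  one-parameter families: \<open>exp(c x)\<close> with \<open>c\<close> in the field, and \<open>t\<^sub>h(s)\<close> with \<open>s\<close> nonzero. Interpolating
  the parameter linearly joins every generator to the identity, and pointwise products of curves are
  curves, so products of connected sets are connected (\<open>rationally_connected_comp\<close>). For \<open>t\<^sub>h(s)\<close> the
  interpolated parameter may vanish, and negative powers of it occur as eigenvalues; therefore a
  curve is defined only off a finite set of parameters, and its coefficients are quotients of
  polynomials.

  What remains is to know that the operators in question are what they are meant to be. The sum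
  that defines \<open>exp(x)\<close> is an exponential only where \<open>x\<close> is locally nilpotent, and \<open>t\<^sub>h(s)\<close> and \<open>e(R)\<close>
  are given by definite descriptions. For the latter one needs that the module is the direct sum of
  its weight spaces (\<open>ex1_diagonal\<close>). For the former one uses that real root vectors shift weights
  along a real root, and that such a string of weights ends
  (\<open>real_root_nilpotent_on\<close>): for a simple root because every weight of \<open>L(\<Lambda>)\<close> is \<open>\<Lambda>\<close> minus a
  nonnegative combination of simple roots, and for a general real root because the weights of
  \<open>L(\<Lambda>)\<close> are permuted by the Weyl group (\<open>weyl_real_weights\<close>). That invariance is the usual
  sl2-argument, which rests on the local nilpotence of \<open>e\<^sub>i\<close> and \<open>f\<^sub>i\<close>; for \<open>f\<^sub>i\<close> it follows from the
  Serre relations once \<open>f\<^sub>i\<close> is nilpotent on the highest weight vector, where the contravariant form is used.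
\<close>

section \<open>Regular functions off a set of parameters\<close>

text \<open>These are the regular functions on the complement of \<open>S\<close> in the affine line, extended to \<open>S\<close> by
arbitrary values.\<close>

definition regular :: "'k::field set \<Rightarrow> ('k \<Rightarrow> 'k) \<Rightarrow> bool" where
  "regular S f \<longleftrightarrow> (\<exists>p d. \<forall>s. s \<notin> S \<longrightarrow> poly d s \<noteq> 0 \<and> f s = poly p s / poly d s)"

lemma regular_poly: "regular S (poly p)"
  unfolding regular_def by (rule exI[of _ p], rule exI[of _ 1]) simp

lemma regular_cong: "regular S f \<Longrightarrow> (\<And>s. s \<notin> S \<Longrightarrow> g s = f s) \<Longrightarrow> regular S g"
  unfolding regular_def by metis

lemma regular_const: "regular S (\<lambda>s. c)"
  by (rule regular_cong[OF regular_poly[of S "[:c:]"]]) simp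

lemma regular_add:
  assumes "regular S f" "regular S g"
  shows "regular S (\<lambda>s. f s + g s)"
proof -
  obtain p d q e where
    "\<And>s. s \<notin> S \<Longrightarrow> poly d s \<noteq> 0 \<and> f s = poly p s / poly d s"
    "\<And>s. s \<notin> S \<Longrightarrow> poly e s \<noteq> 0 \<and> g s = poly q s / poly e s"
    using assms unfolding regular_def by metis
  then show ?thesis
    unfolding regular_def
    by (intro exI[of _ "p * e + q * d"] exI[of _ "d * e"]) (simp add: add_frac_eq)
qed

lemma regular_mult:
  assumes "regular S f" "regular S g"
  shows "regular S (\<lambda>s. f s * g s)"
proof -
  obtain p d q e where
    "\<And>s. s \<notin> S \<Longrightarrow> poly d s \<noteq> 0 \<and> f s = poly p s / poly d s"
    "\<And>s. s \<notin> S \<Longrightarrow> poly e s \<noteq> 0 \<and> g s = poly q s / poly e s"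
    using assms unfolding regular_def by metis
  then show ?thesis
    unfolding regular_def
    by (intro exI[of _ "p * q"] exI[of _ "d * e"]) simp
qed

lemma regular_powi:
  assumes "\<And>s. s \<notin> S \<Longrightarrow> poly p s \<noteq> 0"
  shows "regular S (\<lambda>s. poly p s powi m)"
proof (cases "m \<ge> 0")
  case True
  then show ?thesis
    by (intro regular_cong[OF regular_poly[of S "p ^ nat m"]]) (simp add: power_int_def)
next
  case False
  then show ?thesis unfolding regular_def
    by (intro exI[of _ 1] exI[of _ "p ^ nat (- m)"])
      (simp add: assms power_int_def field_simps)
qed

lemma regular_mono: "regular S f \<Longrightarrow> S \<subseteq> S' \<Longrightarrow> regular S' f"
  unfolding regular_def by blast

lemma regular_finite_zeros:
  assumes "regular S f" "a \<notin> S" "f a \<noteq> 0"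
  shows "finite {s. s \<notin> S \<and> f s = 0}"
proof -
  obtain p d where pd: "\<And>s. s \<notin> S \<Longrightarrow> poly d s \<noteq> 0 \<and> f s = poly p s / poly d s"
    using assms unfolding regular_def by metis
  then have "p \<noteq> 0" using assms by force
  then have "finite {s. poly p s = 0}" by (rule poly_roots_finite)
  then show ?thesis by (rule finite_subset[rotated]) (use pd in auto)
qed

text \<open>This is where the infinity of the field enters: a nonzero numerator has finitely many roots, so
the parameters to be avoided form a finite set.\<close>

lemma regular_common_nonzero:
  fixes f g :: "'k::field_char_0 \<Rightarrow> 'k"
  assumes "finite S" "regular S f" "a \<notin> S" "f a \<noteq> 0" "regular S g" "b \<notin> S" "g b \<noteq> 0"
  obtains s where "s \<notin> S" "f s \<noteq> 0" "g s \<noteq> 0"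
proof -
  let ?Z = "S \<union> {s. s \<notin> S \<and> f s = 0} \<union> {s. s \<notin> S \<and> g s = 0}"
  have "finite ?Z"
    using assms(1) regular_finite_zeros[OF assms(2-4)] regular_finite_zeros[OF assms(5-7)] by simp
  from ex_new_if_finite[OF infinite_UNIV_char_0 this] obtain s where "s \<notin> ?Z" ..
  then show ?thesis using that by blast
qed

text \<open>Functions that are, off \<open>S\<close>, finite linear combinations of vectors of \<open>M\<close> with regular
coefficients. The inductive form, with equalities required off \<open>S\<close> only, makes every closure
property a rule induction.\<close>

inductive regular_vec ::
  "('k::field \<Rightarrow> 'b::ab_group_add \<Rightarrow> 'b) \<Rightarrow> 'k set \<Rightarrow> 'b set \<Rightarrow> ('k \<Rightarrow> 'b) \<Rightarrow> bool"
  for scale S M where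
  single: "regular S f \<Longrightarrow> v \<in> M \<Longrightarrow> (\<And>s. s \<notin> S \<Longrightarrow> F s = scale (f s) v) \<Longrightarrow>
    regular_vec scale S M F"
| add: "regular_vec scale S M F \<Longrightarrow> regular_vec scale S M G \<Longrightarrow>
    (\<And>s. s \<notin> S \<Longrightarrow> H s = F s + G s) \<Longrightarrow> regular_vec scale S M H"

context vector_space
begin

lemma regular_vec_const: "v \<in> M \<Longrightarrow> regular_vec scale S M (\<lambda>s. v)"
  by (rule regular_vec.single[where f = "\<lambda>s. 1"]) (auto intro: regular_const)

lemma regular_vec_cong:
  assumes F: "regular_vec scale S M F" and G: "\<And>s. s \<notin> S \<Longrightarrow> G s = F s"
  shows "regular_vec scale S M G"
  using F
proof cases
  case (single f v)
  show ?thesis by (rule regular_vec.single[OF single(1,2)]) (simp add: G single(3))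
next
  case (add F1 F2)
  show ?thesis by (rule regular_vec.add[OF add(1,2)]) (simp add: G add(3))
qed

lemma regular_vec_mono:
  assumes "regular_vec scale S M F" and sub: "S \<subseteq> S'"
  shows "regular_vec scale S' M F"
  using assms(1)
proof (induction rule: regular_vec.induct)
  case (single f v F)
  show ?case
    by (rule regular_vec.single[OF regular_mono[OF single(1) sub] single(2)])
      (use single(3) sub in blast)
next
  case (add F G H)
  show ?case by (rule regular_vec.add[OF add.IH]) (use add(3) sub in blast)
qed

lemma regular_vec_scale:
  assumes "regular_vec scale S M F" and g: "regular S g"
  shows "regular_vec scale S M (\<lambda>s. scale (g s) (F s))"
  using assms(1)
proof (induction rule: regular_vec.induct)
  case (single f v F)
  show ?case
    by (rule regular_vec.single[OF regular_mult[OF g single(1)] single(2)]) (simp add: single(3))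
next
  case (add F G H)
  show ?case by (rule regular_vec.add[OF add.IH]) (simp add: add(3) scale_right_distrib)
qed

lemma regular_vec_mem:
  "regular_vec scale S M F \<Longrightarrow> subspace M \<Longrightarrow> s \<notin> S \<Longrightarrow> F s \<in> M"
  by (induction rule: regular_vec.induct) (auto intro: subspace_add subspace_scale)

lemma regular_vec_sum:
  assumes "finite A" "\<And>i. i \<in> A \<Longrightarrow> regular_vec scale S M (F i)" "subspace M"
  shows "regular_vec scale S M (\<lambda>s. \<Sum>i\<in>A. F i s)"
  using assms(1,2)
proof (induction A)
  case empty
  then show ?case using regular_vec_const[OF subspace_0[OF assms(3)]] by simp
next
  case (insert i A)
  show ?case
    by (rule regular_vec.add[of _ _ _ "F i" "\<lambda>s. \<Sum>i\<in>A. F i s"]) (use insert in auto)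
qed

lemma regular_vec_functional:
  assumes "regular_vec scale S M F" "subspace M"
    and "\<And>u v. u \<in> M \<Longrightarrow> v \<in> M \<Longrightarrow> l (u + v) = l u + l v"
    and "\<And>c v. v \<in> M \<Longrightarrow> l (scale c v) = c * l v"
  shows "regular S (\<lambda>s. l (F s))"
  using assms(1)
proof (induction rule: regular_vec.induct)
  case (single f v F)
  show ?case
    by (rule regular_cong[OF regular_mult[OF single(1) regular_const[of S "l v"]]])
      (simp add: single assms(4))
next
  case (add F G H)
  show ?case
    by (rule regular_cong[OF regular_add[OF add.IH]])
      (simp add: add(3) assms(3) regular_vec_mem[OF add(1) assms(2)] regular_vec_mem[OF add(2) assms(2)])
qed

end

section \<open>Groups and monoids generated by bijections\<close>

lemma group_gen_subset_units:
  assumes S: "\<And>g. g \<in> S \<Longrightarrow> bij g \<and> g \<in> monoid_gen R \<and> inv g \<in> monoid_gen R"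
    and g: "g \<in> group_gen S"
  shows "bij g \<and> g \<in> monoid_gen R \<and> inv g \<in> monoid_gen R"
  using g
proof (induction rule: group_gen.induct)
  case 1
  show ?case using monoid_gen.intros(1) by (metis bij_id inv_id)
next
  case (2 x)
  then show ?case by (rule S)
next
  case (3 x y)
  then have "inv (x \<circ> y) = inv y \<circ> inv x" by (intro o_inv_distrib) auto
  then show ?case using 3 monoid_gen.intros(3) by (metis bij_comp)
next
  case (4 x)
  then show ?case by (simp add: bij_imp_bij_inv inv_inv_eq)
qed

text \<open>A generating set closed under inversion gives the same group and monoid, so that inverses need not be
treated separately when elements are joined by curves.\<close>

lemma group_gen_eq_monoid_gen:
  assumes "\<And>g. g \<in> S \<Longrightarrow> bij g \<and> inv g \<in> S"
  shows "group_gen S = monoid_gen S"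
proof
  show "group_gen S \<subseteq> monoid_gen S"
    using group_gen_subset_units[of S S] assms monoid_gen.intros(2)[of _ S] by blast
  show "monoid_gen S \<subseteq> group_gen S"
  proof
    fix g assume "g \<in> monoid_gen S"
    then show "g \<in> group_gen S" by (induction rule: monoid_gen.induct) (blast intro: group_gen.intros)+
  qed
qed

section \<open>Direct sums of eigenspaces\<close>

text \<open>On a direct sum of subspaces, prescribed scalings of the summands come from one linear map. It is
defined on a basis of vectors each lying in one summand; the independence of the summands then
shows that it scales all of \<open>W i\<close>, and not just the basis vectors in it.\<close>

lemma (in vector_space) ex_linear_scaling:
  fixes W :: "'i \<Rightarrow> 'b set"
  assumes sub: "\<And>i. i \<in> I \<Longrightarrow> subspace (W i)"
    and indep: "\<And>A u. finite A \<Longrightarrow> A \<subseteq> I \<Longrightarrow> (\<And>i. i \<in> A \<Longrightarrow> u i \<in> W i) \<Longrightarrow> (\<Sum>i\<in>A. u i) = 0 \<Longrightarrow>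
      \<forall>i\<in>A. u i = 0"
    and span: "span (\<Union>i\<in>I. W i) = UNIV"
  shows "\<exists>\<phi>. Vector_Spaces.linear scale scale \<phi> \<and> (\<forall>i\<in>I. \<forall>v\<in>W i. \<phi> v = scale (c i) v)"
proof -
  interpret VV: vector_space_pair scale scale ..
  obtain B where B: "B \<subseteq> (\<Union>i\<in>I. W i)" "independent B" "(\<Union>i\<in>I. W i) \<subseteq> span B"
    using maximal_independent_subset[of "\<Union>i\<in>I. W i"] by blast
  have "\<forall>b\<in>B. \<exists>i. i \<in> I \<and> b \<in> W i" using B(1) by blast
  then obtain k where k: "\<And>b. b \<in> B \<Longrightarrow> k b \<in> I" "\<And>b. b \<in> B \<Longrightarrow> b \<in> W (k b)" by metis
  obtain \<phi> where lin: "Vector_Spaces.linear scale scale \<phi>"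
    and \<phi>: "\<And>b. b \<in> B \<Longrightarrow> \<phi> b = scale (c (k b)) b"
    using VV.linear_independent_extend[OF B(2), of "\<lambda>b. scale (c (k b)) b"] by blast
  interpret \<phi>: Vector_Spaces.linear scale scale \<phi> by (rule lin)
  have "\<phi> v = scale (c i) v" if i: "i \<in> I" and v: "v \<in> W i" for i v
  proof -
    have "v \<in> span B" using B(3) i v by blast
    then obtain t r where t: "finite t" "t \<subseteq> B" and vt: "v = (\<Sum>b\<in>t. scale (r b) b)"
      unfolding span_explicit by blast
    define A where "A = insert i (k ` t)"
    define y where "y j = (\<Sum>b\<in>{b\<in>t. k b = j}. scale (r b) b)" for j
    have A: "finite A" "A \<subseteq> I" "i \<in> A" using t k i by (auto simp: A_def)
    have y: "y j \<in> W j" if "j \<in> A" for j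
      unfolding y_def using that k t(2) A(2)
      by (intro subspace_sum subspace_scale sub) auto
    have group: "(\<Sum>b\<in>t. g b) = (\<Sum>j\<in>A. \<Sum>b\<in>{b\<in>t. k b = j}. g b)" for g :: "'b \<Rightarrow> 'b"
      by (rule sum.group[symmetric]) (use t(1) A(1) in \<open>auto simp: A_def\<close>)
    have vy: "v = (\<Sum>j\<in>A. y j)" unfolding vt y_def by (rule group)
    have "\<forall>j\<in>A. y j - (if j = i then v else 0) = 0"
    proof (rule indep[OF A(1,2)])
      show "y j - (if j = i then v else 0) \<in> W j" if "j \<in> A" for j
        using y[OF that] v A(2) that sub[of j] by (auto intro: subspace_diff)
      show "(\<Sum>j\<in>A. y j - (if j = i then v else 0)) = 0"
        using A vy by (simp add: sum_subtractf)
    qed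
    then have y_eq: "y j = (if j = i then v else 0)" if "j \<in> A" for j using that by auto
    have "\<phi> v = (\<Sum>b\<in>t. scale (c (k b)) (scale (r b) b))"
      unfolding vt \<phi>.sum using t(2) by (intro sum.cong) (auto simp: \<phi>.scale \<phi> mult.commute)
    also have "\<dots> = (\<Sum>j\<in>A. scale (c j) (y j))"
      unfolding group y_def by (intro sum.cong) (auto simp: scale_sum_right)
    also have "\<dots> = (\<Sum>j\<in>A. if j = i then scale (c i) v else 0)"
      by (intro sum.cong) (auto simp: y_eq)
    also have "\<dots> = scale (c i) v" using A by simp
    finally show ?thesis .
  qed
  with lin show ?thesis by (intro exI[of _ \<phi>] conjI ballI)
qed

lemma (in vector_space) span_UN_decomp:
  fixes W :: "'i \<Rightarrow> 'b set"
  assumes sub: "\<And>i. i \<in> J \<Longrightarrow> subspace (W i)" and v: "v \<in> span (\<Union>i\<in>J. W i)"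
  obtains A y where "finite A" "A \<subseteq> J" "\<And>i. i \<in> A \<Longrightarrow> y i \<in> W i" "v = (\<Sum>i\<in>A. y i)"
proof -
  obtain t r where t: "finite t" "t \<subseteq> (\<Union>i\<in>J. W i)" and vt: "v = (\<Sum>b\<in>t. scale (r b) b)"
    using v unfolding span_explicit by blast
  have "\<forall>b\<in>t. \<exists>i. i \<in> J \<and> b \<in> W i" using t(2) by blast
  then obtain k where k: "\<And>b. b \<in> t \<Longrightarrow> k b \<in> J" "\<And>b. b \<in> t \<Longrightarrow> b \<in> W (k b)" by metis
  have "(\<Sum>b\<in>t. scale (r b) b) = (\<Sum>j\<in>k ` t. \<Sum>b\<in>{b\<in>t. k b = j}. scale (r b) b)"
    by (rule sum.group[symmetric]) (use t(1) in auto)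
  moreover have "(\<Sum>b\<in>{b\<in>t. k b = j}. scale (r b) b) \<in> W j" if "j \<in> J" for j
    using that k by (intro subspace_sum subspace_scale sub) auto
  ultimately show ?thesis using that[of "k ` t" "\<lambda>j. \<Sum>b\<in>{b\<in>t. k b = j}. scale (r b) b"] t(1) k(1) vt by auto
qed

section \<open>Weight vectors\<close>

locale kac_moody =
  fixes D :: "('k::field_char_0, 'n::finite, 'h::ab_group_add, 'g::ab_group_add, 'v::ab_group_add) km_data"
  assumes setting: "kac_moody_setting D"
begin

lemma vector_space_vscale: "vector_space (vscale D)"
  using setting by (simp add: kac_moody_setting_def lie_module_def)

lemma lie_algebra_bracket: "lie_algebra (gscale D) (bracket D)"
  using setting by (simp add: kac_moody_setting_def kac_moody_algebra_def)

sublocale V: vector_space "vscale D" by (rule vector_space_vscale)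
sublocale VV: vector_space_pair "vscale D" "vscale D" ..
sublocale g: lie_algebra "gscale D" "bracket D" by (rule lie_algebra_bracket)

abbreviation lin :: "('v \<Rightarrow> 'v) \<Rightarrow> bool" where
  "lin \<equiv> Vector_Spaces.linear (vscale D) (vscale D)"

abbreviation wsp :: "('h \<Rightarrow> int) \<Rightarrow> 'v set" where
  "wsp \<equiv> weight_space D"

abbreviation \<alpha> :: "'n \<Rightarrow> 'h \<Rightarrow> int" where
  "\<alpha> \<equiv> simple_root D"

lemma lin_act: "lin (act D x)"
  using setting by (simp add: kac_moody_setting_def lie_module_def)

lemmas act_add = VV.linear_add[OF lin_act]
  and act_scale = VV.linear_scale[OF lin_act]
  and act_zero = VV.linear_0[OF lin_act]

lemma act_left:
  "act D (x + y) v = act D x v + act D y v"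
  "act D (gscale D c x) v = vscale D c (act D x v)"
  "act D (bracket D x y) v = act D x (act D y v) - act D y (act D x v)"
  using setting by (simp_all add: kac_moody_setting_def lie_module_def)

lemma act_left_zero: "act D 0 v = 0"
  using act_left(1)[of 0 0 v] by simp

lemma lin_compose: "lin f \<Longrightarrow> lin g \<Longrightarrow> lin (f \<circ> g)"
  by (rule Vector_Spaces.linear_compose)

lemma lin_funpow: "lin f \<Longrightarrow> lin (f ^^ n)"
  by (induction n) (simp_all only: funpow.simps lin_compose V.linear_id)

lemma lie_evalI: "km_eq D s t \<Longrightarrow> lie_eval D s = lie_eval D t"
  using setting by (simp add: kac_moody_setting_def kac_moody_algebra_def)

lemma to_g_add: "to_g D (x + y) = to_g D x + to_g D y"
  using lie_evalI[OF km_eq.h_add[of D x y]] by simp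

lemma to_g_uminus: "to_g D (- x) = - to_g D x"
proof -
  have "to_g D 0 = 0" using to_g_add[of 0 0] by simp
  then show ?thesis using to_g_add[of x "- x"] by (simp add: eq_neg_iff_add_eq_0 add.commute)
qed

lemma chev_e_root: "chev_e D i \<in> root_space D (\<alpha> i)"
  unfolding root_space_def using lie_evalI[OF km_eq.h_e[of D _ i]] by simp

lemma chev_f_root: "chev_f D i \<in> root_space D (\<lambda>h. - \<alpha> i h)"
  unfolding root_space_def using lie_evalI[OF km_eq.h_f[of D _ i]] by simp

lemma bracket_e_f:
  "bracket D (chev_e D i) (chev_f D j) = (if i = j then to_g D (coroot D i) else 0)"
  using lie_evalI[OF km_eq.e_f[of D i j]] by (simp split: if_splits)

lemma bracket_anti: "bracket D x y = - bracket D y x"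
proof -
  have "0 = bracket D (x + y) (x + y)" by (simp add: g.bracket_self)
  also have "\<dots> = bracket D x y + bracket D y x"
    by (simp only: g.bracket_add_left g.bracket_add_right) (simp add: g.bracket_self)
  finally show ?thesis by (simp add: eq_neg_iff_add_eq_0)
qed

lemma lie_eval_ad_pow:
  "lie_eval D ((Brk s ^^ n) t) = (bracket D (lie_eval D s) ^^ n) (lie_eval D t)"
  by (induction n) auto

lemma ad_f_nilpotent: "\<exists>n. (bracket D (chev_f D i) ^^ n) (chev_f D j) = 0"
proof (cases "i = j")
  case True
  then have "(bracket D (chev_f D i) ^^ 1) (chev_f D j) = 0" by (simp add: g.bracket_self)
  then show ?thesis by blast
next
  case False
  then show ?thesis
    using lie_evalI[OF km_eq.serre_f[of i j D]] unfolding lie_eval_ad_pow by auto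
qed

lemma subspace_wsp: "V.subspace (wsp \<mu>)"
  by (rule V.subspaceI)
    (auto simp: weight_space_def act_add act_scale act_zero V.scale_right_distrib mult.commute)

lemma root_space_act:
  assumes "x \<in> root_space D \<beta>" "v \<in> wsp \<mu>"
  shows "act D x v \<in> wsp (\<lambda>h. \<mu> h + \<beta> h)"
proof -
  have "act D (to_g D h) (act D x v) = vscale D (of_int (\<mu> h + \<beta> h)) (act D x v)" for h
  proof -
    have "act D (bracket D (to_g D h) x) v = act D (to_g D h) (act D x v) - act D x (act D (to_g D h) v)"
      by (rule act_left)
    then show ?thesis using assms
      by (simp add: root_space_def weight_space_def act_left(2) act_scale V.scale_left_distrib algebra_simps)
  qed
  then show ?thesis by (simp add: weight_space_def)
qed

lemma root_space_act_pow:
  assumes "x \<in> root_space D \<beta>" "v \<in> wsp \<mu>"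
  shows "(act D x ^^ k) v \<in> wsp (\<lambda>h. \<mu> h + int k * \<beta> h)"
proof (induction k)
  case (Suc k)
  then show ?case using root_space_act[OF assms(1) Suc] by (simp add: algebra_simps)
qed (use assms in simp)

text \<open>Simultaneous eigenvectors for distinct eigenvalues are independent: applying \<open>h - \<nu>(h)\<close> to a relation
removes the term of weight \<open>\<nu>\<close> and multiplies the term of weight \<open>\<mu>\<close> by \<open>\<mu>(h) - \<nu>(h)\<close>, which is
nonzero for some \<open>h\<close>, since integers embed into a field of characteristic \<open>0\<close>.\<close>

lemma wsp_independent:
  assumes "finite A" "\<And>\<mu>. \<mu> \<in> A \<Longrightarrow> u \<mu> \<in> wsp \<mu>" "(\<Sum>\<mu>\<in>A. u \<mu>) = 0"
  shows "\<forall>\<mu>\<in>A. u \<mu> = 0"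
  using assms
proof (induction A arbitrary: u rule: finite_induct)
  case (insert \<nu> A)
  have uw: "act D (to_g D h) (u \<mu>) = vscale D (of_int (\<mu> h)) (u \<mu>)" if "\<mu> \<in> insert \<nu> A" for \<mu> h
    using insert.prems(1)[OF that] by (simp add: weight_space_def)
  have *: "vscale D (of_int (\<mu> h - \<nu> h)) (u \<mu>) = 0" if "\<mu> \<in> A" for \<mu> h
  proof -
    have s: "(\<Sum>\<mu>\<in>insert \<nu> A. vscale D (of_int (\<mu> h)) (u \<mu>)) = 0"
    proof -
      have "(\<Sum>\<mu>\<in>insert \<nu> A. vscale D (of_int (\<mu> h)) (u \<mu>)) =
          act D (to_g D h) (\<Sum>\<mu>\<in>insert \<nu> A. u \<mu>)"
        unfolding VV.linear_sum[OF lin_act] by (rule sum.cong) (simp_all add: uw)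
      then show ?thesis by (simp add: insert.prems(2) act_zero)
    qed
    have "(\<Sum>\<mu>\<in>insert \<nu> A. vscale D (of_int (\<mu> h - \<nu> h)) (u \<mu>)) =
        (\<Sum>\<mu>\<in>insert \<nu> A. vscale D (of_int (\<mu> h)) (u \<mu>)) -
        vscale D (of_int (\<nu> h)) (\<Sum>\<mu>\<in>insert \<nu> A. u \<mu>)"
      by (simp only: V.scale_sum_right sum_subtractf[symmetric] of_int_diff V.scale_left_diff_distrib)
    also have "\<dots> = 0" by (simp only: s insert.prems(2) V.scale_zero_right diff_zero)
    finally have "(\<Sum>\<mu>\<in>A. vscale D (of_int (\<mu> h - \<nu> h)) (u \<mu>)) = 0"
      using insert.hyps by simp
    moreover have "vscale D (of_int (\<mu> h - \<nu> h)) (u \<mu>) \<in> wsp \<mu>" if "\<mu> \<in> A" for \<mu>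
      using that insert.prems(1) V.subspace_scale[OF subspace_wsp] by blast
    ultimately show ?thesis
      using insert.IH[of "\<lambda>\<mu>. vscale D (of_int (\<mu> h - \<nu> h)) (u \<mu>)"] that by blast
  qed
  have "u \<mu> = 0" if "\<mu> \<in> A" for \<mu>
  proof -
    have "\<mu> \<noteq> \<nu>" using that insert.hyps by blast
    then obtain h where "\<mu> h \<noteq> \<nu> h" by (auto simp: fun_eq_iff)
    then show ?thesis using *[OF that, of h] by simp
  qed
  then show ?case using insert.prems(2) insert.hyps by simp
qed simp

lemma wsp_in_span:
  assumes "v \<in> V.span (\<Union>\<mu>\<in>J. wsp \<mu>)" "v \<in> wsp \<nu>" "v \<noteq> 0"
  shows "\<nu> \<in> J"
proof (rule ccontr)
  assume \<nu>: "\<nu> \<notin> J"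
  obtain A y where A: "finite A" "A \<subseteq> J" "\<And>\<mu>. \<mu> \<in> A \<Longrightarrow> y \<mu> \<in> wsp \<mu>" "v = (\<Sum>\<mu>\<in>A. y \<mu>)"
    using V.span_UN_decomp[OF subspace_wsp assms(1)] by blast
  \<comment> \<open>If \<open>\<nu>\<close> is not in \<open>J\<close>, moving \<open>v\<close> to the other side gives a nontrivial relation between weight vectors.\<close>
  define u where "u \<mu> = (if \<mu> = \<nu> then - v else y \<mu>)" for \<mu>
  have \<nu>A: "\<nu> \<notin> A" using A(2) \<nu> by blast
  have "(\<Sum>\<mu>\<in>A. u \<mu>) = (\<Sum>\<mu>\<in>A. y \<mu>)" using \<nu>A by (intro sum.cong) (auto simp: u_def)
  then have s: "(\<Sum>\<mu>\<in>insert \<nu> A. u \<mu>) = 0" using A(1,4) \<nu>A by (simp add: u_def)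
  have w: "u \<mu> \<in> wsp \<mu>" if "\<mu> \<in> insert \<nu> A" for \<mu>
    using that A(3) assms(2) V.subspace_neg[OF subspace_wsp] by (auto simp: u_def)
  have "\<forall>\<mu>\<in>insert \<nu> A. u \<mu> = 0"
  proof (rule wsp_independent)
    show "finite (insert \<nu> A)" using A(1) by simp
    show "u \<mu> \<in> wsp \<mu>" if "\<mu> \<in> insert \<nu> A" for \<mu> by (rule w[OF that])
    show "(\<Sum>\<mu>\<in>insert \<nu> A. u \<mu>) = 0" by (rule s)
  qed
  then have "u \<nu> = 0" by blast
  then show False using assms(3) by (simp add: u_def)
qed

subsection \<open>Highest weight modules are spanned by weight vectors\<close>

text \<open>The vector \<open>f_word is v\<close> is \<open>f\<^bsub>i1\<^esub> (f\<^bsub>i2\<^esub> (\<dots> v))\<close>; for a highest weight vector \<open>v\<close> these vectors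
replace the enveloping algebra of the negative part.\<close>

definition f_word :: "'n list \<Rightarrow> 'v \<Rightarrow> 'v" where
  "f_word is v = foldr (\<lambda>i. act D (chev_f D i)) is v"

definition f_weight :: "('h \<Rightarrow> int) \<Rightarrow> 'n list \<Rightarrow> 'h \<Rightarrow> int" where
  "f_weight \<Lambda> is = (\<lambda>h. \<Lambda> h - (\<Sum>i\<leftarrow>is. \<alpha> i h))"

lemma f_word_simps [simp]:
  "f_word [] v = v" "f_word (i # is) v = act D (chev_f D i) (f_word is v)"
  by (simp_all add: f_word_def)

lemma f_word_weight:
  assumes "v \<in> wsp \<Lambda>"
  shows "f_word is v \<in> wsp (f_weight \<Lambda> is)"
proof (induction "is")
  case Nil
  then show ?case using assms by (simp add: f_weight_def)
next
  case (Cons i "is")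
  then show ?case using root_space_act[OF chev_f_root[of i] Cons] by (simp add: f_weight_def algebra_simps)
qed

lemma submodule_L: "\<Lambda> \<in> dominant_weights D \<Longrightarrow> submodule D (L D \<Lambda>)"
  using setting by (simp add: kac_moody_setting_def irreducible_highest_weight_def)

lemma subspace_L: "\<Lambda> \<in> dominant_weights D \<Longrightarrow> V.subspace (L D \<Lambda>)"
  using submodule_L by (simp add: submodule_def)

lemma act_L: "\<Lambda> \<in> dominant_weights D \<Longrightarrow> v \<in> L D \<Lambda> \<Longrightarrow> act D x v \<in> L D \<Lambda>"
  using submodule_L by (simp add: submodule_def)

lemma act_pow_L: "\<Lambda> \<in> dominant_weights D \<Longrightarrow> v \<in> L D \<Lambda> \<Longrightarrow> (act D x ^^ k) v \<in> L D \<Lambda>"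
  by (induction k) (auto intro: act_L)

text \<open>The span of the \<open>f\<close>-words is stable under each \<open>e\<^sub>j\<close>, because \<open>e\<^sub>j\<close> can be moved through a word at the
cost of terms in which \<open>h\<close> acts by a scalar. So it is a submodule containing the generating vector.\<close>

lemma ex_hw_vector:
  assumes \<Lambda>: "\<Lambda> \<in> dominant_weights D"
  shows "\<exists>v. v \<in> L D \<Lambda> \<and> v \<in> wsp \<Lambda> \<and> (\<forall>i. act D (chev_e D i) v = 0) \<and>
    L D \<Lambda> = V.span (range (\<lambda>is. f_word is v))"
proof -
  have "\<exists>v\<in>L D \<Lambda>. v \<noteq> 0 \<and> v \<in> wsp \<Lambda> \<and> (\<forall>i. act D (chev_e D i) v = 0) \<and>
      (\<forall>S. submodule D S \<and> v \<in> S \<longrightarrow> L D \<Lambda> \<subseteq> S)"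
    using setting \<Lambda> by (simp add: kac_moody_setting_def irreducible_highest_weight_def)
  then obtain v where v: "v \<in> L D \<Lambda>" "v \<noteq> 0" "v \<in> wsp \<Lambda>" "\<And>i. act D (chev_e D i) v = 0"
    and min: "\<And>S. submodule D S \<Longrightarrow> v \<in> S \<Longrightarrow> L D \<Lambda> \<subseteq> S"
    by (elim bexE conjE) simp
  let ?S = "V.span (range (\<lambda>is. f_word is v))"
  have word: "f_word is v \<in> ?S" for "is" by (rule V.span_base) blast
  have stable: "act D x u \<in> ?S" if "u \<in> ?S" and w: "\<And>is. act D x (f_word is v) \<in> ?S" for x u
    using that(1)
  proof (induction rule: V.span_induct_alt)
    case base
    then show ?case by (simp add: act_zero V.span_zero)
  next
    case (step c b y)
    then have "act D x b \<in> ?S" using w by blast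
    then show ?case using step by (simp add: act_add act_scale V.span_add V.span_scale)
  qed
  have h: "act D (to_g D h) (f_word is v) \<in> ?S" for h "is"
    using f_word_weight[OF v(3), of "is"] by (simp add: weight_space_def V.span_scale word)
  have f: "act D (chev_f D i) (f_word is v) \<in> ?S" for i "is"
    using word[of "i # is"] by simp
  have e: "act D (chev_e D j) (f_word is v) \<in> ?S" for j "is"
  proof (induction "is")
    case Nil
    then show ?case by (simp add: v(4) V.span_zero)
  next
    case (Cons i "is")
    have "act D (chev_e D j) (f_word (i # is) v) =
        act D (bracket D (chev_e D j) (chev_f D i)) (f_word is v) +
        act D (chev_f D i) (act D (chev_e D j) (f_word is v))"
      by (simp add: act_left)
    moreover have "act D (bracket D (chev_e D j) (chev_f D i)) (f_word is v) \<in> ?S"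
      using h by (simp add: bracket_e_f act_left_zero V.span_zero)
    moreover have "act D (chev_f D i) (act D (chev_e D j) (f_word is v)) \<in> ?S"
      by (rule stable[OF Cons f])
    ultimately show ?case by (simp add: V.span_add)
  qed
  have ev: "act D (lie_eval D t) u \<in> ?S" if "u \<in> ?S" for t u
    using that
  proof (induction t arbitrary: u)
    case (GenH x) then show ?case using stable h by simp
  next
    case (GenE x) then show ?case using stable e by simp
  next
    case (GenF x) then show ?case using stable f by simp
  next
    case Zero then show ?case by (simp add: act_left_zero V.span_zero)
  next
    case (Add s t) then show ?case by (simp add: act_left(1) V.span_add)
  next
    case (Scale c s) then show ?case by (simp add: act_left(2) V.span_scale)
  next
    case (Brk s t) then show ?case by (simp add: act_left(3) V.span_diff)
  qed
  have "act D x u \<in> ?S" if "u \<in> ?S" for x u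
  proof -
    have "surj (lie_eval D)"
      using setting by (simp add: kac_moody_setting_def kac_moody_algebra_def)
    then obtain t where "x = lie_eval D t" by (rule surjE)
    then show ?thesis using ev[OF that] by simp
  qed
  then have "submodule D ?S" by (simp add: submodule_def)
  then have "L D \<Lambda> \<subseteq> ?S" by (rule min) (use word[of "[]"] in simp)
  moreover have "f_word is v \<in> L D \<Lambda>" for "is"
    by (induction "is") (auto intro: act_L[OF \<Lambda>] v)
  then have "?S \<subseteq> L D \<Lambda>" by (intro V.span_minimal subspace_L \<Lambda>) auto
  ultimately have "L D \<Lambda> = ?S" by (rule equalityI)
  then show ?thesis using v by (intro exI[of _ v]) simp
qed

definition hw_vector :: "('h \<Rightarrow> int) \<Rightarrow> 'v" where
  "hw_vector \<Lambda> = (SOME v. v \<in> L D \<Lambda> \<and> v \<in> wsp \<Lambda> \<and> (\<forall>i. act D (chev_e D i) v = 0) \<and>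
    L D \<Lambda> = V.span (range (\<lambda>is. f_word is v)))"

lemma hw_vector:
  assumes "\<Lambda> \<in> dominant_weights D"
  shows "hw_vector \<Lambda> \<in> L D \<Lambda>" "hw_vector \<Lambda> \<in> wsp \<Lambda>" "act D (chev_e D i) (hw_vector \<Lambda>) = 0"
    "L D \<Lambda> = V.span (range (\<lambda>is. f_word is (hw_vector \<Lambda>)))"
  using someI_ex[OF ex_hw_vector[OF assms], folded hw_vector_def] by blast+

lemma f_word_L: "\<Lambda> \<in> dominant_weights D \<Longrightarrow> f_word is (hw_vector \<Lambda>) \<in> L D \<Lambda>"
  by (induction "is") (simp_all add: hw_vector(1) act_L)

definition weights :: "('h \<Rightarrow> int) \<Rightarrow> ('h \<Rightarrow> int) set" where
  "weights \<Lambda> = {\<mu>. \<exists>v\<in>L D \<Lambda>. v \<in> wsp \<mu> \<and> v \<noteq> 0}"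

lemma weights_below:
  assumes \<Lambda>: "\<Lambda> \<in> dominant_weights D" and \<mu>: "\<mu> \<in> weights \<Lambda>"
  obtains "is" where "\<mu> = f_weight \<Lambda> is"
proof -
  obtain u where u: "u \<in> L D \<Lambda>" "u \<in> wsp \<mu>" "u \<noteq> 0" using \<mu> by (auto simp: weights_def)
  have "range (\<lambda>is. f_word is (hw_vector \<Lambda>)) \<subseteq> (\<Union>\<nu>\<in>range (f_weight \<Lambda>). wsp \<nu>)"
    using f_word_weight[OF hw_vector(2)[OF \<Lambda>]] by auto
  from V.span_mono[OF this] have "u \<in> V.span (\<Union>\<nu>\<in>range (f_weight \<Lambda>). wsp \<nu>)"
    using u(1) hw_vector(4)[OF \<Lambda>] by (simp add: subset_iff)
  then have "\<mu> \<in> range (f_weight \<Lambda>)" by (rule wsp_in_span) (use u in auto)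
  then obtain "is" where "\<mu> = f_weight \<Lambda> is" by (rule imageE)
  then show ?thesis by (rule that)
qed

lemma root_datum: "root_datum D"
  using setting by (simp add: kac_moody_setting_def)

lemma f_weight_lattice:
  assumes "\<Lambda> \<in> dominant_weights D"
  shows "f_weight \<Lambda> is \<in> weight_lattice D"
proof (induction "is")
  case Nil
  then show ?case using assms by (simp add: f_weight_def dominant_weights_def)
next
  case (Cons i "is")
  have "\<alpha> i \<in> weight_lattice D" using root_datum by (auto simp: root_datum_def)
  then have \<alpha>: "module_hom (zscale D) (*) (\<alpha> i)" by (simp add: weight_lattice_def)
  have w: "module_hom (zscale D) (*) (f_weight \<Lambda> is)" using Cons by (simp add: weight_lattice_def)
  interpret module_pair "zscale D" "(*) :: int \<Rightarrow> int \<Rightarrow> int"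
    using \<alpha> by (simp add: module_hom_def module_pair_def)
  have "module_hom (zscale D) (*) (\<lambda>h. f_weight \<Lambda> is h - \<alpha> i h)"
    by (rule module_hom_sub[OF w \<alpha>])
  then show ?case by (simp add: weight_lattice_def f_weight_def algebra_simps)
qed

lemma weights_lattice:
  assumes \<Lambda>: "\<Lambda> \<in> dominant_weights D" and \<mu>: "\<mu> \<in> weights \<Lambda>"
  shows "\<mu> \<in> weight_lattice D"
proof -
  obtain "is" where "\<mu> = f_weight \<Lambda> is" by (rule weights_below[OF \<Lambda> \<mu>])
  then show ?thesis using f_weight_lattice[OF \<Lambda>] by simp
qed

lemma weight_uminus:
  "\<Lambda> \<in> dominant_weights D \<Longrightarrow> \<mu> \<in> weights \<Lambda> \<Longrightarrow> \<mu> (- h) = - \<mu> h"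
  using weights_lattice[of \<Lambda> \<mu>] module_hom.neg[of "zscale D" "(*)" \<mu> h] by (simp add: weight_lattice_def)

section \<open>Nilpotent action and sl2-strings\<close>

definition nilpotent_on :: "'g \<Rightarrow> 'v \<Rightarrow> bool" where
  "nilpotent_on x v \<longleftrightarrow> (\<exists>n. (act D x ^^ n) v = 0)"

lemma act_pow_zero_mono:
  assumes "(act D x ^^ n) v = 0" "n \<le> m"
  shows "(act D x ^^ m) v = 0"
proof -
  have "(act D x ^^ k) 0 = 0" for k by (induction k) (simp_all add: act_zero)
  moreover have "act D x ^^ m = (act D x ^^ (m - n)) \<circ> (act D x ^^ n)"
    using assms(2) by (simp add: funpow_add[symmetric])
  ultimately show ?thesis using assms(1) by simp
qed

lemma act_pow_lin:
  "(act D x ^^ n) (u + v) = (act D x ^^ n) u + (act D x ^^ n) v"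
  "(act D x ^^ n) (vscale D c v) = vscale D c ((act D x ^^ n) v)"
  "(act D x ^^ n) 0 = 0"
  using VV.linear_add[OF lin_funpow[OF lin_act]] VV.linear_scale[OF lin_funpow[OF lin_act]]
    VV.linear_0[OF lin_funpow[OF lin_act]] by simp_all

lemma subspace_nilpotent_on: "V.subspace {v. nilpotent_on x v}"
proof (rule V.subspaceI)
  show "0 \<in> {v. nilpotent_on x v}" unfolding nilpotent_on_def by (simp add: act_pow_lin(3))
next
  fix u v assume "u \<in> {v. nilpotent_on x v}" "v \<in> {v. nilpotent_on x v}"
  then obtain n m where nm: "(act D x ^^ n) u = 0" "(act D x ^^ m) v = 0"
    by (auto simp: nilpotent_on_def)
  have "(act D x ^^ (max n m)) (u + v) = 0"
    by (simp add: act_pow_lin(1) act_pow_zero_mono[OF nm(1)] act_pow_zero_mono[OF nm(2)])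
  then show "u + v \<in> {v. nilpotent_on x v}" by (auto simp: nilpotent_on_def)
next
  fix c v assume "v \<in> {v. nilpotent_on x v}"
  then obtain n where "(act D x ^^ n) v = 0" by (auto simp: nilpotent_on_def)
  then have "(act D x ^^ n) (vscale D c v) = 0" by (simp add: act_pow_lin(2))
  then show "vscale D c v \<in> {v. nilpotent_on x v}" by (auto simp: nilpotent_on_def)
qed

text \<open>Since \<open>y (x v) = [y, x] v + x (y v)\<close>, each application of \<open>y\<close> is spent either on \<open>x\<close> or on \<open>v\<close>. Hence
the vectors on which \<open>y\<close> is nilpotent are mapped to such vectors by every \<open>x\<close> on which
\<open>ad y\<close> is nilpotent.\<close>

lemma act_pow_act_eq_0:
  assumes "(bracket D y ^^ n) x = 0" "(act D y ^^ m) v = 0"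
  shows "(act D y ^^ (n + m)) (act D x v) = 0"
  using assms
proof (induction "n + m" arbitrary: n m x v)
  case 0
  then show ?case by (simp add: act_left_zero)
next
  case (Suc k)
  show ?case
  proof (cases "n = 0 \<or> m = 0")
    case True
    then have "act D x v = 0" using Suc.prems by (auto simp: act_left_zero act_zero)
    then show ?thesis by (simp add: act_pow_lin(3))
  next
    case False
    then obtain n' m' where nm: "n = Suc n'" "m = Suc m'" by (meson not0_implies_Suc)
    have "(act D y ^^ (n' + m)) (act D (bracket D y x) v) = 0"
      by (rule Suc.hyps(1)) (use Suc nm in \<open>simp_all add: funpow_swap1\<close>)
    moreover have "(act D y ^^ (n + m')) (act D x (act D y v)) = 0"
      by (rule Suc.hyps(1)) (use Suc nm in \<open>simp_all add: funpow_swap1\<close>)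
    moreover have "act D y (act D x v) = act D (bracket D y x) v + act D x (act D y v)"
      by (simp add: act_left(3))
    ultimately have "(act D y ^^ (n' + m)) (act D y (act D x v)) = 0"
      using nm by (simp add: act_pow_lin(1) del: funpow.simps)
    then show ?thesis using nm by (simp add: funpow_swap1)
  qed
qed

text \<open>The basic sl2-computation, for the triple \<open>(x, y, c)\<close>. It is stated for an arbitrary triple because it is
used both for \<open>(e\<^sub>i, f\<^sub>i, h\<^sub>i)\<close> and for \<open>(f\<^sub>i, e\<^sub>i, - h\<^sub>i)\<close>.\<close>

lemma raise_lowering_power:
  assumes v: "v \<in> wsp \<mu>" and e: "act D x v = 0"
    and x: "x \<in> root_space D \<beta>" and y: "y \<in> root_space D (\<lambda>h. - \<beta> h)"
    and xy: "bracket D x y = to_g D c" and c: "\<beta> c = 2"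
  shows "act D x ((act D y ^^ Suc k) v) =
    vscale D (of_nat (Suc k) * of_int (\<mu> c - int k)) ((act D y ^^ k) v)"
proof (induction k)
  have xyu: "act D x (act D y u) = act D y (act D x u) + act D (to_g D c) u" for u
    using act_left(3)[of x y u] by (simp add: xy)
  {
    case 0
    show ?case using v by (simp add: xyu e act_zero weight_space_def)
  next
    case (Suc k)
    let ?u = "(act D y ^^ Suc k) v"
    have "?u \<in> wsp (\<lambda>h. \<mu> h + int (Suc k) * - \<beta> h)"
      by (rule root_space_act_pow[OF y v])
    then have "act D (to_g D c) ?u = vscale D (of_int (\<mu> c + int (Suc k) * - \<beta> c)) ?u"
      unfolding weight_space_def by blast
    moreover have "\<mu> c + int (Suc k) * - \<beta> c = \<mu> c - 2 * int (Suc k)" by (simp add: c)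
    ultimately have h: "act D (to_g D c) ?u = vscale D (of_int (\<mu> c - 2 * int (Suc k))) ?u"
      by (simp only:)
    have "act D x ((act D y ^^ Suc (Suc k)) v) = act D y (act D x ?u) + act D (to_g D c) ?u"
      using xyu[of ?u] by simp
    also have "act D y (act D x ?u) =
        vscale D (of_nat (Suc k) * of_int (\<mu> c - int k)) ?u"
      unfolding Suc.IH by (simp add: act_scale)
    finally have "act D x ((act D y ^^ Suc (Suc k)) v) =
        vscale D (of_nat (Suc k) * of_int (\<mu> c - int k) + of_int (\<mu> c - 2 * int (Suc k))) ?u"
      unfolding h V.scale_left_distrib .
    also have "of_nat (Suc k) * of_int (\<mu> c - int k) + of_int (\<mu> c - 2 * int (Suc k)) =
        (of_nat (Suc (Suc k)) * of_int (\<mu> c - int (Suc k)) :: 'k)"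
      by (simp add: algebra_simps)
    finally show ?case .
  }
qed

section \<open>Real root vectors act locally nilpotently\<close>

lemma form_props:
  assumes \<Lambda>: "\<Lambda> \<in> dominant_weights D"
  shows form_add: "u \<in> L D \<Lambda> \<Longrightarrow> v \<in> L D \<Lambda> \<Longrightarrow> w \<in> L D \<Lambda> \<Longrightarrow>
      form D \<Lambda> w (u + v) = form D \<Lambda> w u + form D \<Lambda> w v"
    and form_scale: "v \<in> L D \<Lambda> \<Longrightarrow> w \<in> L D \<Lambda> \<Longrightarrow> form D \<Lambda> w (vscale D c v) = c * form D \<Lambda> w v"
    and form_sym: "v \<in> L D \<Lambda> \<Longrightarrow> w \<in> L D \<Lambda> \<Longrightarrow> form D \<Lambda> v w = form D \<Lambda> w v"
    and form_nondeg: "v \<in> L D \<Lambda> \<Longrightarrow> (\<And>w. w \<in> L D \<Lambda> \<Longrightarrow> form D \<Lambda> v w = 0) \<Longrightarrow> v = 0"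
    and form_act: "v \<in> L D \<Lambda> \<Longrightarrow> w \<in> L D \<Lambda> \<Longrightarrow>
      form D \<Lambda> v (act D x w) = form D \<Lambda> (act D (star D x) v) w"
proof -
  have "contravariant_form D \<Lambda>" using setting \<Lambda> by (simp add: kac_moody_setting_def)
  note form = this[unfolded contravariant_form_def]
  note add = form[THEN conjunct1] and scale = form[THEN conjunct2, THEN conjunct1]
    and sym = form[THEN conjunct2, THEN conjunct2, THEN conjunct1]
    and nondeg = form[THEN conjunct2, THEN conjunct2, THEN conjunct2, THEN conjunct1]
    and act = form[THEN conjunct2, THEN conjunct2, THEN conjunct2, THEN conjunct2]
  show "v \<in> L D \<Lambda> \<Longrightarrow> w \<in> L D \<Lambda> \<Longrightarrow> form D \<Lambda> v w = form D \<Lambda> w v"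
    using sym by blast
  show "form D \<Lambda> w (u + v) = form D \<Lambda> w u + form D \<Lambda> w v"
    if u: "u \<in> L D \<Lambda>" and v: "v \<in> L D \<Lambda>" and w: "w \<in> L D \<Lambda>"
  proof -
    have "form D \<Lambda> w (u + v) = form D \<Lambda> (u + v) w"
      using bspec[OF bspec[OF sym w] V.subspace_add[OF subspace_L[OF \<Lambda>] u v]] .
    also have "\<dots> = form D \<Lambda> u w + form D \<Lambda> v w" using add u v w by blast
    also have "form D \<Lambda> u w = form D \<Lambda> w u" using sym u w by blast
    also have "form D \<Lambda> v w = form D \<Lambda> w v" using sym v w by blast
    finally show ?thesis .
  qed
  show "form D \<Lambda> w (vscale D c v) = c * form D \<Lambda> w v" if v: "v \<in> L D \<Lambda>" and w: "w \<in> L D \<Lambda>"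
  proof -
    have "form D \<Lambda> w (vscale D c v) = form D \<Lambda> (vscale D c v) w"
      using bspec[OF bspec[OF sym w] V.subspace_scale[OF subspace_L[OF \<Lambda>] v]] .
    also have "\<dots> = c * form D \<Lambda> v w" using scale v w by blast
    also have "form D \<Lambda> v w = form D \<Lambda> w v" using sym v w by blast
    finally show ?thesis .
  qed
  show "v \<in> L D \<Lambda> \<Longrightarrow> (\<And>w. w \<in> L D \<Lambda> \<Longrightarrow> form D \<Lambda> v w = 0) \<Longrightarrow> v = 0"
    using nondeg by blast
  show "v \<in> L D \<Lambda> \<Longrightarrow> w \<in> L D \<Lambda> \<Longrightarrow>
      form D \<Lambda> v (act D x w) = form D \<Lambda> (act D (star D x) v) w"
    using act by blast
qed

lemma star_e_f: "star D (chev_e D i) = chev_f D i" "star D (chev_f D i) = chev_e D i"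
  using setting by (simp_all add: kac_moody_setting_def chevalley_involution_def)

lemma form_zero: "\<Lambda> \<in> dominant_weights D \<Longrightarrow> w \<in> L D \<Lambda> \<Longrightarrow> form D \<Lambda> w 0 = 0"
  using form_scale[of \<Lambda> 0 w 0] V.subspace_0[OF subspace_L[of \<Lambda>]] by simp

text \<open>The vector \<open>f\<^sub>i u\<close> is orthogonal to every \<open>f\<close>-word: to the highest weight vector because the adjoint of
\<open>f\<^sub>i\<close> is \<open>e\<^sub>i\<close>, which kills the highest weight vector, and to longer words because the adjoint \<open>e\<^sub>j\<close>
of the first letter kills \<open>f\<^sub>i u\<close>. The form is nondegenerate.\<close>

lemma singular_vector_zero:
  assumes \<Lambda>: "\<Lambda> \<in> dominant_weights D" and u: "u \<in> L D \<Lambda>"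
    and e: "\<And>j. act D (chev_e D j) (act D (chev_f D i) u) = 0"
  shows "act D (chev_f D i) u = 0"
proof (rule form_nondeg[OF \<Lambda>])
  let ?w = "act D (chev_f D i) u"
  show w: "?w \<in> L D \<Lambda>" by (rule act_L[OF \<Lambda> u])
  have word: "form D \<Lambda> ?w (f_word is (hw_vector \<Lambda>)) = 0" for "is"
  proof (cases "is")
    case Nil
    have "form D \<Lambda> ?w (hw_vector \<Lambda>) = form D \<Lambda> (hw_vector \<Lambda>) ?w"
      by (rule form_sym[OF \<Lambda> w hw_vector(1)[OF \<Lambda>]])
    also have "\<dots> = form D \<Lambda> (act D (chev_e D i) (hw_vector \<Lambda>)) u"
      by (simp add: form_act[OF \<Lambda> hw_vector(1)[OF \<Lambda>] u] star_e_f)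
    also have "\<dots> = form D \<Lambda> u 0"
      using form_sym[OF \<Lambda>, of 0 u] V.subspace_0[OF subspace_L[OF \<Lambda>]] u
      by (simp add: hw_vector(3)[OF \<Lambda>])
    finally show ?thesis using Nil form_zero[OF \<Lambda> u] by simp
  next
    case (Cons j js)
    have "form D \<Lambda> ?w (f_word is (hw_vector \<Lambda>)) = form D \<Lambda> 0 (f_word js (hw_vector \<Lambda>))"
      using Cons form_act[OF \<Lambda> w f_word_L[OF \<Lambda>, of js]] e by (simp add: star_e_f)
    also have "\<dots> = 0"
      using form_sym[OF \<Lambda> _ f_word_L[OF \<Lambda>, of js], of 0] form_zero[OF \<Lambda> f_word_L[OF \<Lambda>, of js]]
        V.subspace_0[OF subspace_L[OF \<Lambda>]] by simp
    finally show ?thesis .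
  qed
  fix v assume "v \<in> L D \<Lambda>"
  then have "v \<in> V.span (range (\<lambda>is. f_word is (hw_vector \<Lambda>)))" using hw_vector(4)[OF \<Lambda>] by simp
  then have "v \<in> L D \<Lambda> \<and> form D \<Lambda> ?w v = 0"
  proof (induction rule: V.span_induct_alt)
    case base
    show ?case using form_zero[OF \<Lambda> w] V.subspace_0[OF subspace_L[OF \<Lambda>]] by simp
  next
    case (step c b y)
    then obtain "is" where b: "b = f_word is (hw_vector \<Lambda>)" by auto
    have bL: "b \<in> L D \<Lambda>" unfolding b by (rule f_word_L[OF \<Lambda>])
    have cb: "vscale D c b \<in> L D \<Lambda>" by (rule V.subspace_scale[OF subspace_L[OF \<Lambda>] bL])
    show ?case
      using step form_add[OF \<Lambda> cb _ w, of y] form_scale[OF \<Lambda> bL w, of c] word[of "is"]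
        V.subspace_add[OF subspace_L[OF \<Lambda>] cb, of y]
      by (simp add: b)
  qed
  then show "form D \<Lambda> ?w v = 0" ..
qed

lemma simple_root_coroot: "\<alpha> i (coroot D i) = 2"
proof -
  have "\<alpha> i (coroot D i) = cartan D $ i $ i" "gen_cartan_matrix (cartan D)"
    using root_datum by (simp_all add: root_datum_def)
  then show ?thesis by (simp add: gen_cartan_matrix_def)
qed

text \<open>With \<open>m = \<Lambda>(h\<^sub>i)\<close>, the vector \<open>f\<^sub>i\<^sup>m\<^sup>+\<^sup>1 v\<close> is killed by all \<open>e\<^sub>j\<close>: for \<open>j \<noteq> i\<close> because \<open>e\<^sub>j\<close> and \<open>f\<^sub>i\<close> commute, and
for \<open>j = i\<close> because the scalar in the sl2-computation is \<open>0\<close>. Dominance of \<open>\<Lambda>\<close> makes \<open>m\<close> a natural number.\<close>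

lemma f_nilpotent_on_hw_vector:
  assumes \<Lambda>: "\<Lambda> \<in> dominant_weights D"
  shows "nilpotent_on (chev_f D i) (hw_vector \<Lambda>)"
proof -
  let ?v = "hw_vector \<Lambda>" and ?f = "chev_f D i"
  have "0 \<le> real_of_int (\<Lambda> (coroot D i))"
    using \<Lambda> by (simp add: dominant_weights_def fundamental_chamber_def to_real_def)
  then have m: "0 \<le> \<Lambda> (coroot D i)" by simp
  define m where "m = nat (\<Lambda> (coroot D i))"
  have comm: "act D (chev_e D j) ((act D ?f ^^ k) ?v) = 0" if "j \<noteq> i" for j k
  proof (induction k)
    case 0
    show ?case by (simp add: hw_vector(3)[OF \<Lambda>])
  next
    case (Suc k)
    have "act D (bracket D (chev_e D j) ?f) ((act D ?f ^^ k) ?v) = 0"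
      using that by (simp add: bracket_e_f act_left_zero)
    then show ?case using Suc by (simp add: act_left(3) act_zero)
  qed
  have "act D (chev_e D i) ((act D ?f ^^ Suc m) ?v) = 0"
    using raise_lowering_power[OF hw_vector(2)[OF \<Lambda>] hw_vector(3)[OF \<Lambda>] chev_e_root chev_f_root, of i "coroot D i" m]
      m bracket_e_f[of i i] simple_root_coroot by (simp add: m_def)
  then have "act D (chev_e D j) (act D ?f ((act D ?f ^^ m) ?v)) = 0" for j
    using comm[of j "Suc m"] by (cases "j = i") simp_all
  then have "act D ?f ((act D ?f ^^ m) ?v) = 0"
    by (rule singular_vector_zero[OF \<Lambda> act_pow_L[OF \<Lambda> hw_vector(1)[OF \<Lambda>]]])
  then have "(act D ?f ^^ Suc m) ?v = 0" by simp
  then show ?thesis unfolding nilpotent_on_def by blast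
qed

lemma f_nilpotent_on:
  assumes \<Lambda>: "\<Lambda> \<in> dominant_weights D" and v: "v \<in> L D \<Lambda>"
  shows "nilpotent_on (chev_f D i) v"
proof -
  have "nilpotent_on (chev_f D i) (f_word is (hw_vector \<Lambda>))" for "is"
  proof (induction "is")
    case Nil
    show ?case using f_nilpotent_on_hw_vector[OF \<Lambda>] by simp
  next
    case (Cons j "is")
    then obtain m where m: "(act D (chev_f D i) ^^ m) (f_word is (hw_vector \<Lambda>)) = 0"
      by (auto simp: nilpotent_on_def)
    obtain n where n: "(bracket D (chev_f D i) ^^ n) (chev_f D j) = 0"
      using ad_f_nilpotent by blast
    show ?case unfolding nilpotent_on_def
      by (rule exI[of _ "n + m"]) (use act_pow_act_eq_0[OF n m] in simp)
  qed
  then have "V.span (range (\<lambda>is. f_word is (hw_vector \<Lambda>))) \<subseteq> {v. nilpotent_on (chev_f D i) v}"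
    by (intro V.span_minimal subspace_nilpotent_on) auto
  then show ?thesis using v hw_vector(4)[OF \<Lambda>] by auto
qed

lemma simple_roots_independent:
  assumes "\<And>h. (\<Sum>j\<in>UNIV. c j * \<alpha> j h) = 0"
  shows "c i = 0"
proof -
  have inj: "inj \<alpha>" and ind: "\<not> module.dependent (\<lambda>(c::int) \<mu> x. c * \<mu> x) (range \<alpha>)"
    using root_datum by (simp_all add: root_datum_def)
  interpret P: module "\<lambda>(c::int) (\<mu> :: 'h \<Rightarrow> int) x. c * \<mu> x"
    by standard (auto simp: fun_eq_iff algebra_simps)
  have "(\<Sum>v\<in>range \<alpha>. (\<lambda>x. c (inv \<alpha> v) * v x)) = (\<Sum>j\<in>UNIV. (\<lambda>x. c j * \<alpha> j x))"
    using sum.reindex[OF inj, of "\<lambda>v x. c (inv \<alpha> v) * v x"] by (simp add: inj o_def)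
  also have "\<dots> = 0"
  proof
    fix h
    have "(\<Sum>j\<in>A. (\<lambda>x. c j * \<alpha> j x)) h = (\<Sum>j\<in>A. c j * \<alpha> j h)" for A
      by (induction A rule: infinite_finite_induct) simp_all
    then show "(\<Sum>j\<in>UNIV. (\<lambda>x. c j * \<alpha> j x)) h = 0 h" using assms[of h] by simp
  qed
  finally have "c (inv \<alpha> (\<alpha> i)) = 0"
    by (intro P.independentD[OF ind, of "range \<alpha>" "\<lambda>v. c (inv \<alpha> v)"]) auto
  then show ?thesis by (simp add: inj)
qed

lemma f_weight_count: "f_weight \<Lambda> is h = \<Lambda> h - (\<Sum>j\<in>UNIV. int (count_list is j) * \<alpha> j h)"
proof (induction "is")
  case (Cons i "is")
  have "(\<Sum>j\<in>UNIV. int (count_list (i # is) j) * \<alpha> j h) =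
      (\<Sum>j\<in>UNIV. int (count_list is j) * \<alpha> j h + (if i = j then \<alpha> j h else 0))"
    by (intro sum.cong) (auto simp: algebra_simps)
  also have "\<dots> = (\<Sum>j\<in>UNIV. int (count_list is j) * \<alpha> j h) + \<alpha> i h"
    by (simp add: sum.distrib)
  finally show ?case using Cons by (simp add: f_weight_def)
qed (simp add: f_weight_def)

text \<open>All weights have the form \<open>\<Lambda> - \<Sum> c\<^sub>j \<alpha>\<^sub>j\<close> with \<open>c\<^sub>j\<close> natural. The simple roots are independent, so each step
along \<open>\<alpha>\<^sub>i\<close> lowers \<open>c\<^sub>i\<close> by one.\<close>

lemma simple_root_string_bounded:
  assumes \<Lambda>: "\<Lambda> \<in> dominant_weights D" and \<mu>: "\<mu> \<in> weights \<Lambda>"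
  obtains K where "\<And>k. k \<ge> K \<Longrightarrow> (\<lambda>h. \<mu> h + int k * \<alpha> i h) \<notin> weights \<Lambda>"
proof -
  obtain js where js: "\<mu> = f_weight \<Lambda> js" by (rule weights_below[OF \<Lambda> \<mu>])
  have "k \<le> count_list js i" if k: "(\<lambda>h. \<mu> h + int k * \<alpha> i h) \<in> weights \<Lambda>" for k
  proof -
    obtain ls where "(\<lambda>h. \<mu> h + int k * \<alpha> i h) = f_weight \<Lambda> ls" by (rule weights_below[OF \<Lambda> k])
    then have ls: "f_weight \<Lambda> ls h = f_weight \<Lambda> js h + int k * \<alpha> i h" for h
      using js by (simp add: fun_eq_iff)
    \<comment> \<open>The coefficients of the relation between simple roots that results from the two
      descriptions of the weight \<open>\<mu> + k \<alpha>\<^sub>i\<close>.\<close>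
    let ?c = "\<lambda>j. int (count_list ls j) - int (count_list js j) + (if j = i then int k else 0)"
    have "(\<Sum>j\<in>UNIV. ?c j * \<alpha> j h) = 0" for h
    proof -
      have "(\<Sum>j\<in>UNIV. ?c j * \<alpha> j h) =
          (\<Sum>j\<in>UNIV. int (count_list ls j) * \<alpha> j h - int (count_list js j) * \<alpha> j h
            + (if j = i then int k * \<alpha> j h else 0))"
        by (intro sum.cong) (auto simp: algebra_simps)
      also have "\<dots> = (\<Sum>j\<in>UNIV. int (count_list ls j) * \<alpha> j h)
          - (\<Sum>j\<in>UNIV. int (count_list js j) * \<alpha> j h) + int k * \<alpha> i h"
        by (simp add: sum.distrib sum_subtractf)
      also have "\<dots> = 0" using ls[of h] by (simp add: f_weight_count)
      finally show ?thesis .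
    qed
    then have "?c i = 0" by (rule simple_roots_independent)
    then show ?thesis by simp
  qed
  then have "(\<lambda>h. \<mu> h + int k * \<alpha> i h) \<notin> weights \<Lambda>" if "k \<ge> Suc (count_list js i)" for k
    using that by (meson not_less_eq_eq)
  then show ?thesis by (rule that)
qed

lemma e_nilpotent_on_weight:
  assumes \<Lambda>: "\<Lambda> \<in> dominant_weights D" and v: "v \<in> L D \<Lambda>" "v \<in> wsp \<mu>" "v \<noteq> 0"
  shows "nilpotent_on (chev_e D i) v"
proof -
  have "\<mu> \<in> weights \<Lambda>" using v by (auto simp: weights_def)
  then obtain K where K: "\<And>k. k \<ge> K \<Longrightarrow> (\<lambda>h. \<mu> h + int k * \<alpha> i h) \<notin> weights \<Lambda>"
    by (rule simple_root_string_bounded[OF \<Lambda>]) blast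
  have "(act D (chev_e D i) ^^ K) v \<in> wsp (\<lambda>h. \<mu> h + int K * \<alpha> i h)"
    by (rule root_space_act_pow[OF chev_e_root v(2)])
  then have "(act D (chev_e D i) ^^ K) v = 0"
    using K[of K] act_pow_L[OF \<Lambda> v(1)] by (auto simp: weights_def)
  then show ?thesis by (auto simp: nilpotent_on_def)
qed

text \<open>Raise \<open>v\<close> by \<open>x\<close> as far as possible, say \<open>q\<close> times. The resulting vector is killed by \<open>x\<close> and has
\<open>c\<close>-weight \<open>N = \<mu>(c) + 2 q\<close>, so \<open>y\<close> can be applied \<open>N\<close> times to it without reaching \<open>0\<close>. Already
\<open>q + \<mu>(c)\<close> applications lead to the weight \<open>\<mu> - \<mu>(c) \<beta>\<close>.\<close>

lemma reflected_weight:
  assumes \<Lambda>: "\<Lambda> \<in> dominant_weights D" and v: "v \<in> L D \<Lambda>" "v \<in> wsp \<mu>" "v \<noteq> 0"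
    and nil: "nilpotent_on x v"
    and x: "x \<in> root_space D \<beta>" and y: "y \<in> root_space D (\<lambda>h. - \<beta> h)"
    and xy: "bracket D x y = to_g D c" and c: "\<beta> c = 2" and \<mu>c: "0 \<le> \<mu> c"
  shows "(\<lambda>h. \<mu> h - \<mu> c * \<beta> h) \<in> weights \<Lambda>"
proof -
  \<comment> \<open>\<open>Suc q\<close> is the first power of \<open>x\<close> that kills \<open>v\<close>, so \<open>x\<^sup>q v\<close> is nonzero and killed by \<open>x\<close>.\<close>
  define q where "q = (LEAST q. (act D x ^^ Suc q) v = 0)"
  have ex: "\<exists>q. (act D x ^^ Suc q) v = 0"
  proof -
    obtain n where "(act D x ^^ n) v = 0" using nil by (auto simp: nilpotent_on_def)
    then have "(act D x ^^ Suc n) v = 0" by (rule act_pow_zero_mono) simp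
    then show ?thesis by blast
  qed
  have q: "(act D x ^^ Suc q) v = 0" unfolding q_def by (rule LeastI_ex[OF ex])
  define w where "w = (act D x ^^ q) v"
  have w0: "w \<noteq> 0"
  proof (cases q)
    case 0
    then show ?thesis using v(3) by (simp add: w_def)
  next
    case (Suc p)
    then have "\<not> (act D x ^^ Suc p) v = 0" 
      using not_less_Least[of p "\<lambda>q. (act D x ^^ Suc q) v = 0", folded q_def] by simp
    then show ?thesis using Suc by (simp add: w_def)
  qed
  have xw: "act D x w = 0" using q by (simp add: w_def)
  let ?\<nu> = "\<lambda>h. \<mu> h + int q * \<beta> h"
  have w: "w \<in> wsp ?\<nu>" unfolding w_def by (rule root_space_act_pow[OF x v(2)])
  have nz: "(act D y ^^ k) w \<noteq> 0" if "int k \<le> ?\<nu> c" for k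
    using that
  proof (induction k)
    case 0
    show ?case using w0 by simp
  next
    case (Suc k)
    have "(of_nat (Suc k) :: 'k) * of_int (?\<nu> c - int k) \<noteq> 0"
      using Suc.prems by (simp del: of_nat_Suc of_int_diff of_int_add)
    then have "act D x ((act D y ^^ Suc k) w) \<noteq> 0"
      using raise_lowering_power[OF w xw x y xy c, of k] Suc by simp
    then show ?case using act_zero by metis
  qed
  define k where "k = q + nat (\<mu> c)"
  have "int k \<le> ?\<nu> c" using \<mu>c c by (simp add: k_def)
  then have "(act D y ^^ k) w \<noteq> 0" by (rule nz)
  moreover have "(act D y ^^ k) w \<in> wsp (\<lambda>h. ?\<nu> h + int k * - \<beta> h)"
    by (rule root_space_act_pow[OF y w])
  moreover have "(\<lambda>h. ?\<nu> h + int k * - \<beta> h) = (\<lambda>h. \<mu> h - \<mu> c * \<beta> h)"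
    using \<mu>c by (auto simp: k_def algebra_simps)
  moreover have "(act D y ^^ k) w \<in> L D \<Lambda>"
    unfolding w_def by (intro act_pow_L \<Lambda> v(1))
  ultimately show ?thesis by (auto simp: weights_def)
qed

text \<open>The string argument starts from a nonnegative value \<open>\<mu>(h\<^sub>i)\<close>. Exchanging \<open>e\<^sub>i\<close> and \<open>f\<^sub>i\<close> changes the sign of
the coroot and so covers the negative values; it is here that the local nilpotence of \<open>f\<^sub>i\<close> enters.\<close>

lemma simple_reflection_weights:
  assumes \<Lambda>: "\<Lambda> \<in> dominant_weights D" and \<mu>: "\<mu> \<in> weights \<Lambda>"
  shows "(\<lambda>h. \<mu> h - \<mu> (coroot D i) * \<alpha> i h) \<in> weights \<Lambda>"
proof -
  obtain v where v: "v \<in> L D \<Lambda>" "v \<in> wsp \<mu>" "v \<noteq> 0" using \<mu> by (auto simp: weights_def)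
  show ?thesis
  proof (cases "0 \<le> \<mu> (coroot D i)")
    case True
    show ?thesis
      by (rule reflected_weight[OF \<Lambda> v e_nilpotent_on_weight[OF \<Lambda> v] chev_e_root chev_f_root])
        (use True bracket_e_f[of i i] simple_root_coroot in auto)
  next
    case False
    have "\<alpha> i (- coroot D i) = - \<alpha> i (coroot D i)"
    proof -
      have "\<alpha> i \<in> weight_lattice D" using root_datum by (auto simp: root_datum_def)
      then show ?thesis using module_hom.neg[of "zscale D" "(*)" "\<alpha> i"] by (simp add: weight_lattice_def)
    qed
    moreover have "bracket D (chev_f D i) (chev_e D i) = to_g D (- coroot D i)"
      using bracket_anti[of "chev_f D i" "chev_e D i"] by (simp add: bracket_e_f to_g_uminus)
    moreover have "chev_e D i \<in> root_space D (\<lambda>h. - (- \<alpha> i h))" using chev_e_root by simp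
    ultimately have "(\<lambda>h. \<mu> h - \<mu> (- coroot D i) * - \<alpha> i h) \<in> weights \<Lambda>"
      using False simple_root_coroot weight_uminus[OF \<Lambda> \<mu>]
      by (intro reflected_weight[OF \<Lambda> v f_nilpotent_on[OF \<Lambda> v(1)] chev_f_root]) auto
    then show ?thesis by (simp add: weight_uminus[OF \<Lambda> \<mu>])
  qed
qed

section \<open>The Weyl group permutes the weights\<close>

text \<open>The Weyl group acts on real functionals, whereas weights are integral ones.\<close>

definition real_weights :: "('h \<Rightarrow> int) \<Rightarrow> ('h \<Rightarrow> real) set" where
  "real_weights \<Lambda> = to_real ` weights \<Lambda>"

lemma to_real_mem_real_weights: "to_real \<mu> \<in> real_weights \<Lambda> \<longleftrightarrow> \<mu> \<in> weights \<Lambda>"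
  by (auto simp: real_weights_def to_real_def fun_eq_iff image_iff) (metis ext)

lemma reflection_apply: "reflection D i \<nu> = (\<lambda>h. \<nu> h - \<nu> (coroot D i) * of_int (\<alpha> i h))"
  by (simp add: reflection_def to_real_def scaleR_fun_def fun_eq_iff)

lemma reflection_involution: "reflection D i \<circ> reflection D i = id"
  using simple_root_coroot[of i] by (simp add: reflection_apply fun_eq_iff)

lemma reflection_real_weights:
  assumes "\<Lambda> \<in> dominant_weights D" "\<nu> \<in> real_weights \<Lambda>"
  shows "reflection D i \<nu> \<in> real_weights \<Lambda>"
proof -
  obtain \<mu> where \<mu>: "\<mu> \<in> weights \<Lambda>" "\<nu> = to_real \<mu>" using assms(2) by (auto simp: real_weights_def)
  have "reflection D i \<nu> = to_real (\<lambda>h. \<mu> h - \<mu> (coroot D i) * \<alpha> i h)"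
    by (simp add: reflection_apply \<mu>(2) to_real_def)
  then show ?thesis using simple_reflection_weights[OF assms(1) \<mu>(1)] by (simp add: to_real_mem_real_weights)
qed

lemma bij_weyl: "\<sigma> \<in> weyl_group D \<Longrightarrow> bij \<sigma>"
  unfolding weyl_group_def
proof (induction rule: group_gen.induct)
  case (2 x)
  then show ?case using reflection_involution by (auto intro: o_bij)
qed (blast intro: bij_id bij_comp bij_imp_bij_inv)+

lemma weyl_linear:
  "\<sigma> \<in> weyl_group D \<Longrightarrow> \<sigma> (\<lambda>h. a h + c * b h) = (\<lambda>h. \<sigma> a h + c * \<sigma> b h)"
  unfolding weyl_group_def
proof (induction arbitrary: a b rule: group_gen.induct)
  case (2 x)
  then show ?case by (auto simp: reflection_apply algebra_simps)
next
  case (4 x)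
  have bij: "bij x" using 4(1) bij_weyl by (simp add: weyl_group_def)
  have "inv x (\<lambda>h. a h + c * b h) = inv x (\<lambda>h. x (inv x a) h + c * x (inv x b) h)"
    using bij by (simp add: bij_is_surj surj_f_inv_f)
  also have "\<dots> = inv x (x (\<lambda>h. inv x a h + c * inv x b h))" by (simp only: 4(2))
  also have "\<dots> = (\<lambda>h. inv x a h + c * inv x b h)" using bij by (simp add: bij_is_inj)
  finally show ?case .
qed simp_all

lemma weyl_real_weights:
  assumes \<Lambda>: "\<Lambda> \<in> dominant_weights D" and \<sigma>: "\<sigma> \<in> weyl_group D"
  shows "\<sigma> \<nu> \<in> real_weights \<Lambda> \<longleftrightarrow> \<nu> \<in> real_weights \<Lambda>"
  using \<sigma> unfolding weyl_group_def
proof (induction arbitrary: \<nu> rule: group_gen.induct)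
  case (2 x)
  then obtain i where x: "x = reflection D i" by blast
  have "reflection D i (reflection D i \<nu>) = \<nu>" using reflection_involution by (simp add: fun_eq_iff)
  then show ?case using reflection_real_weights[OF \<Lambda>, of _ i] unfolding x by metis
next
  case (4 x)
  have "bij x" using 4(1) bij_weyl by (simp add: weyl_group_def)
  then have "x (inv x \<nu>) = \<nu>" by (simp add: bij_is_surj surj_f_inv_f)
  then show ?case using 4(2)[of "inv x \<nu>"] by simp
qed simp_all

lemma span_L: "V.span (\<Union>\<Lambda>\<in>dominant_weights D. L D \<Lambda>) = UNIV"
  using setting by (simp add: kac_moody_setting_def internal_direct_sum_def)

lemma f_word_wsp:
  "\<Lambda> \<in> dominant_weights D \<Longrightarrow> f_word is (hw_vector \<Lambda>) \<in> wsp (f_weight \<Lambda> is)"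
  by (rule f_word_weight[OF hw_vector(2)])

lemma L_induct:
  assumes \<Lambda>: "\<Lambda> \<in> dominant_weights D" and sub: "V.subspace {v. P v}"
    and word: "\<And>v \<mu>. v \<in> L D \<Lambda> \<Longrightarrow> \<mu> \<in> weight_lattice D \<Longrightarrow> v \<in> wsp \<mu> \<Longrightarrow> P v"
    and v: "v \<in> L D \<Lambda>"
  shows "P v"
proof -
  have "P (f_word is (hw_vector \<Lambda>))" for "is"
    by (rule word[OF f_word_L[OF \<Lambda>] f_weight_lattice[OF \<Lambda>] f_word_wsp[OF \<Lambda>]])
  then have "V.span (range (\<lambda>is. f_word is (hw_vector \<Lambda>))) \<subseteq> {v. P v}"
    by (intro V.span_minimal sub) auto
  then show ?thesis using v hw_vector(4)[OF \<Lambda>] by auto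
qed

lemma V_induct:
  assumes sub: "V.subspace {v. P v}"
    and word: "\<And>\<Lambda> v \<mu>. \<Lambda> \<in> dominant_weights D \<Longrightarrow> v \<in> L D \<Lambda> \<Longrightarrow> \<mu> \<in> weight_lattice D \<Longrightarrow>
      v \<in> wsp \<mu> \<Longrightarrow> P v"
  shows "P v"
proof -
  have "P v" if "\<Lambda> \<in> dominant_weights D" "v \<in> L D \<Lambda>" for \<Lambda> v
    using L_induct[OF that(1) sub word[OF that(1)] that(2)] .
  then have "V.span (\<Union>\<Lambda>\<in>dominant_weights D. L D \<Lambda>) \<subseteq> {v. P v}"
    by (intro V.span_minimal sub) auto
  then show ?thesis using span_L by auto
qed

text \<open>If all powers of \<open>x\<close> were nonzero on a vector of weight \<open>\<mu>\<close>, all \<open>\<mu> + k \<beta>\<close> would be weights. Writing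
\<open>\<beta> = \<sigma> \<alpha>\<^sub>i\<close> and applying \<open>\<sigma>\<^sup>-\<^sup>1\<close> would give an unbounded string of weights along \<open>\<alpha>\<^sub>i\<close>.\<close>

lemma real_root_nilpotent_on:
  assumes \<beta>: "\<beta> \<in> real_roots D" and x: "x \<in> root_space D \<beta>"
  shows "nilpotent_on x v"
proof (rule V_induct[OF subspace_nilpotent_on])
  fix \<Lambda> v \<mu> assume \<Lambda>: "\<Lambda> \<in> dominant_weights D" and v: "v \<in> L D \<Lambda>" "v \<in> wsp \<mu>"
  obtain \<sigma> i where \<sigma>: "\<sigma> \<in> weyl_group D" and \<beta>\<sigma>: "to_real \<beta> = \<sigma> (to_real (\<alpha> i))"
    using \<beta> by (auto simp: real_roots_def)
  show "nilpotent_on x v"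
  proof (rule ccontr)
    assume not_nilp: "\<not> nilpotent_on x v"
    define \<nu> where "\<nu> = inv \<sigma> (to_real \<mu>)"
    have \<mu>\<nu>: "to_real \<mu> = \<sigma> \<nu>" using bij_weyl[OF \<sigma>] by (simp add: \<nu>_def bij_is_surj surj_f_inv_f)
    have str: "(\<lambda>h. \<nu> h + real k * to_real (\<alpha> i) h) \<in> real_weights \<Lambda>" for k
    proof -
      have "(act D x ^^ k) v \<noteq> 0" using not_nilp by (auto simp: nilpotent_on_def)
      moreover have "(act D x ^^ k) v \<in> wsp (\<lambda>h. \<mu> h + int k * \<beta> h)"
        by (rule root_space_act_pow[OF x v(2)])
      moreover have "(act D x ^^ k) v \<in> L D \<Lambda>" by (rule act_pow_L[OF \<Lambda> v(1)])
      ultimately have "(\<lambda>h. \<mu> h + int k * \<beta> h) \<in> weights \<Lambda>" unfolding weights_def by blast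
      then have "to_real (\<lambda>h. \<mu> h + int k * \<beta> h) \<in> real_weights \<Lambda>" by (simp add: to_real_mem_real_weights)
      moreover have "to_real (\<lambda>h. \<mu> h + int k * \<beta> h) = (\<lambda>h. to_real \<mu> h + real k * to_real \<beta> h)"
        by (simp add: to_real_def)
      moreover have "\<dots> = \<sigma> (\<lambda>h. \<nu> h + real k * to_real (\<alpha> i) h)"
        unfolding weyl_linear[OF \<sigma>] \<mu>\<nu> \<beta>\<sigma> ..
      ultimately show ?thesis using weyl_real_weights[OF \<Lambda> \<sigma>] by simp
    qed
    from str[of 0] have "\<nu> \<in> real_weights \<Lambda>" by simp
    then obtain \<mu>' where \<mu>': "\<mu>' \<in> weights \<Lambda>" "\<nu> = to_real \<mu>'" by (auto simp: real_weights_def)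
    obtain K where K: "(\<lambda>h. \<mu>' h + int K * \<alpha> i h) \<notin> weights \<Lambda>"
      by (rule simple_root_string_bounded[OF \<Lambda> \<mu>'(1), of i]) blast
    have "(\<lambda>h. \<nu> h + real K * to_real (\<alpha> i) h) = to_real (\<lambda>h. \<mu>' h + int K * \<alpha> i h)"
      by (simp add: \<mu>'(2) to_real_def)
    then show False using str[of K] K by (simp add: to_real_mem_real_weights)
  qed
qed

section \<open>Exponentials\<close>

text \<open>The sum defining the exponential depends on the vector through its index set. Replacing that by a
fixed range makes linear algebra with exponentials possible.\<close>

lemma exp_op_eq:
  assumes "(act D x ^^ n) v = 0"
  shows "exp_op D x v = (\<Sum>k<n. vscale D (1 / fact k) ((act D x ^^ k) v))"
  unfolding exp_op_def
proof (rule sum.mono_neutral_left)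
  show "{k. (act D x ^^ k) v \<noteq> 0} \<subseteq> {..<n}"
    using act_pow_zero_mono[OF assms] by (auto simp: not_le[symmetric])
qed auto

definition locally_nilpotent :: "'g \<Rightarrow> bool" where
  "locally_nilpotent x \<longleftrightarrow> (\<forall>v. nilpotent_on x v)"

lemma locally_nilpotentE:
  assumes "locally_nilpotent x"
  obtains n where "(act D x ^^ n) v = 0"
  using assms by (auto simp: locally_nilpotent_def nilpotent_on_def)

lemma exp_op_lin:
  assumes x: "locally_nilpotent x"
  shows "lin (exp_op D x)"
  unfolding Vector_Spaces.linear_iff
proof (intro conjI allI vector_space_vscale)
  fix u v
  obtain n where n: "(act D x ^^ n) u = 0" by (rule locally_nilpotentE[OF x])
  obtain m where m: "(act D x ^^ m) v = 0" by (rule locally_nilpotentE[OF x])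
  have u: "(act D x ^^ max n m) u = 0" and v: "(act D x ^^ max n m) v = 0"
    using act_pow_zero_mono[OF n, of "max n m"] act_pow_zero_mono[OF m, of "max n m"] by simp_all
  then have "(act D x ^^ max n m) (u + v) = 0" by (simp add: act_pow_lin)
  then show "exp_op D x (u + v) = exp_op D x u + exp_op D x v"
    by (simp add: exp_op_eq[OF u] exp_op_eq[OF v] exp_op_eq act_pow_lin V.scale_right_distrib sum.distrib)
next
  fix c v
  obtain n where n: "(act D x ^^ n) v = 0" by (rule locally_nilpotentE[OF x])
  then have "(act D x ^^ n) (vscale D c v) = 0" by (simp add: act_pow_lin)
  then show "exp_op D x (vscale D c v) = vscale D c (exp_op D x v)"
    by (simp add: exp_op_eq[OF n] exp_op_eq act_pow_lin V.scale_sum_right mult.commute)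
qed

lemma act_pow_gscale: "(act D (gscale D c x) ^^ k) v = vscale D (c ^ k) ((act D x ^^ k) v)"
  by (induction k) (simp_all add: act_left act_scale)

lemma locally_nilpotent_gscale: "locally_nilpotent x \<Longrightarrow> locally_nilpotent (gscale D c x)"
  unfolding locally_nilpotent_def nilpotent_on_def by (metis act_pow_gscale V.scale_zero_right)

lemma exp_op_gscale:
  assumes "(act D x ^^ n) v = 0"
  shows "exp_op D (gscale D c x) v = (\<Sum>k<n. vscale D (c ^ k / fact k) ((act D x ^^ k) v))"
proof -
  have "(act D (gscale D c x) ^^ n) v = 0" using assms by (simp add: act_pow_gscale)
  then show ?thesis by (simp add: exp_op_eq act_pow_gscale)
qed

lemma gscale_neg: "gscale D (- 1) x = - x"
  by simp

lemma exp_op_neg: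
  assumes x: "locally_nilpotent x"
  shows "exp_op D (- x) \<circ> exp_op D x = id"
proof
  fix v
  obtain n where n: "(act D x ^^ n) v = 0" by (rule locally_nilpotentE[OF x])
  let ?X = "\<lambda>k. (act D x ^^ k) v"
  have lin: "lin (exp_op D (- x))"
    using exp_op_lin[OF locally_nilpotent_gscale[OF x, of "- 1"]] by (simp add: gscale_neg)
  have inner: "exp_op D (- x) (?X k) = (\<Sum>j<n - k. vscale D ((- 1) ^ j / fact j) (?X (k + j)))"
    if "k < n" for k
  proof -
    have pw: "(act D x ^^ j) (?X k) = ?X (k + j)" for j
      by (simp add: funpow_add add.commute)
    have "(act D x ^^ (n - k)) (?X k) = 0" using that n by (simp add: pw)
    then show ?thesis using exp_op_gscale[of "n - k" x "?X k" "- 1"] by (simp add: gscale_neg pw)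
  qed
  \<comment> \<open>The coefficient of \<open>x\<^sup>m\<close> in the product of the two series is \<open>(1 - 1)\<^sup>m / m!\<close>.\<close>
  have coeff: "(\<Sum>k\<le>m. 1 / fact k * ((- 1) ^ (m - k) / fact (m - k)) :: 'k) = (if m = 0 then 1 else 0)" for m
  proof -
    have "(\<Sum>k\<le>m. 1 / fact k * ((- 1) ^ (m - k) / fact (m - k)) :: 'k) =
        (\<Sum>k\<le>m. of_nat (m choose k) * 1 ^ k * (- 1) ^ (m - k)) / fact m"
      unfolding sum_divide_distrib
      by (intro sum.cong) (auto simp: binomial_fact field_simps)
    also have "\<dots> = (1 + (- 1)) ^ m / fact m" by (simp only: binomial_ring)
    finally show ?thesis by (simp add: power_0_left)
  qed
  have "exp_op D (- x) (exp_op D x v) = (\<Sum>k<n. vscale D (1 / fact k) (exp_op D (- x) (?X k)))"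
    unfolding exp_op_eq[OF n] VV.linear_sum[OF lin] VV.linear_scale[OF lin] ..
  also have "\<dots> = (\<Sum>k<n. \<Sum>j<n - k. vscale D (1 / fact k * ((- 1) ^ j / fact j)) (?X (k + j)))"
    by (intro sum.cong) (auto simp: inner V.scale_sum_right)
  also have "\<dots> = (\<Sum>(k, j)\<in>{(k, j). k + j < n}. vscale D (1 / fact k * ((- 1) ^ j / fact j)) (?X (k + j)))"
    by (subst sum.Sigma) (auto intro!: sum.cong)
  also have "\<dots> = (\<Sum>m<n. \<Sum>k\<le>m. vscale D (1 / fact k * ((- 1) ^ (m - k) / fact (m - k))) (?X (k + (m - k))))"
    by (rule sum.triangle_reindex)
  also have "\<dots> = (\<Sum>m<n. vscale D (\<Sum>k\<le>m. 1 / fact k * ((- 1) ^ (m - k) / fact (m - k))) (?X m))"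
    unfolding V.scale_sum_left by (intro sum.cong refl) auto
  also have "\<dots> = (\<Sum>m<n. if m = 0 then v else 0)"
    unfolding coeff by (rule sum.cong) auto
  also have "\<dots> = v" using n by (cases n) (auto simp: sum.delta)
  finally show "(exp_op D (- x) \<circ> exp_op D x) v = id v" by simp
qed

lemma exp_op_inverse:
  assumes "locally_nilpotent x"
  shows "bij (exp_op D x) \<and> inv (exp_op D x) = exp_op D (- x)"
proof -
  have "locally_nilpotent (- x)" using locally_nilpotent_gscale[OF assms, of "- 1"] by simp
  then have "exp_op D x \<circ> exp_op D (- x) = id" using exp_op_neg[of "- x"] by simp
  then show ?thesis using exp_op_neg[OF assms] o_bij inv_unique_comp by blast
qed

lemma exp_op_L:
  assumes "\<Lambda> \<in> dominant_weights D" "v \<in> L D \<Lambda>"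
  shows "exp_op D x v \<in> L D \<Lambda>"
  unfolding exp_op_def
  by (intro V.subspace_sum V.subspace_scale subspace_L assms act_pow_L)

lemma root_space_uminus: "x \<in> root_space D \<beta> \<Longrightarrow> - x \<in> root_space D \<beta>"
  and root_space_gscale: "x \<in> root_space D \<beta> \<Longrightarrow> gscale D c x \<in> root_space D \<beta>"
proof -
  show *: "gscale D c x \<in> root_space D \<beta>" if "x \<in> root_space D \<beta>" for c x
    using that by (simp add: root_space_def g.bracket_scale_right mult.commute)
  show "- x \<in> root_space D \<beta>" if "x \<in> root_space D \<beta>" using *[OF that, of "- 1"] by simp
qed

section \<open>Diagonal operators\<close>

lemma span_wsp: "V.span (\<Union>\<mu>\<in>weight_lattice D. wsp \<mu>) = UNIV"
proof -
  have "V.subspace {v. v \<in> V.span (\<Union>\<mu>\<in>weight_lattice D. wsp \<mu>)}" by simp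
  then have "v \<in> V.span (\<Union>\<mu>\<in>weight_lattice D. wsp \<mu>)" for v
    by (rule V_induct) (auto intro: V.span_base)
  then show ?thesis by blast
qed

lemma lin_eq_on_weights:
  assumes "lin f" "lin g" "\<And>\<mu> v. \<mu> \<in> weight_lattice D \<Longrightarrow> v \<in> wsp \<mu> \<Longrightarrow> f v = g v"
  shows "f = g"
proof
  fix v
  have "v \<in> V.span (\<Union>\<mu>\<in>weight_lattice D. wsp \<mu>)" using span_wsp by simp
  then show "f v = g v" by (rule VV.linear_eq_on[OF assms(1,2)]) (use assms(3) in auto)
qed

text \<open>This justifies the definite descriptions in the definitions of \<open>t\<^sub>h(s)\<close> and \<open>e(R)\<close>.\<close>

lemma ex1_diagonal:
  "\<exists>!\<phi>. lin \<phi> \<and> (\<forall>\<mu>\<in>weight_lattice D. \<forall>v\<in>wsp \<mu>. \<phi> v = vscale D (c \<mu>) v)"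
proof (rule ex_ex1I)
  show "\<exists>\<phi>. lin \<phi> \<and> (\<forall>\<mu>\<in>weight_lattice D. \<forall>v\<in>wsp \<mu>. \<phi> v = vscale D (c \<mu>) v)"
    by (rule V.ex_linear_scaling[OF subspace_wsp _ span_wsp]) (rule wsp_independent)
next
  fix \<phi> \<psi>
  assume "lin \<phi> \<and> (\<forall>\<mu>\<in>weight_lattice D. \<forall>v\<in>wsp \<mu>. \<phi> v = vscale D (c \<mu>) v)"
    and "lin \<psi> \<and> (\<forall>\<mu>\<in>weight_lattice D. \<forall>v\<in>wsp \<mu>. \<psi> v = vscale D (c \<mu>) v)"
  then show "\<phi> = \<psi>" by (intro lin_eq_on_weights) auto
qed

lemma torus_elt_diagonal:
  "lin (torus_elt D x s)"
  "\<mu> \<in> weight_lattice D \<Longrightarrow> v \<in> wsp \<mu> \<Longrightarrow> torus_elt D x s v = vscale D (s powi \<mu> x) v"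
  using theI'[OF ex1_diagonal[of "\<lambda>\<mu>. s powi \<mu> x"]] by (auto simp: torus_elt_def)

lemma face_idem_diagonal:
  "lin (face_idem D R)"
  "\<mu> \<in> weight_lattice D \<Longrightarrow> v \<in> wsp \<mu> \<Longrightarrow> face_idem D R v = (if to_real \<mu> \<in> R then v else 0)"
proof -
  have eq: "vscale D (if P then 1 else 0) v = (if P then v else 0)" for P v by simp
  show "lin (face_idem D R)"
  "\<mu> \<in> weight_lattice D \<Longrightarrow> v \<in> wsp \<mu> \<Longrightarrow> face_idem D R v = (if to_real \<mu> \<in> R then v else 0)"
    using theI'[OF ex1_diagonal[of "\<lambda>\<mu>. if to_real \<mu> \<in> R then 1 else 0"]]
    unfolding eq face_idem_def by auto
qed

lemma lin_maps_L:
  assumes \<Lambda>: "\<Lambda> \<in> dominant_weights D" and lin: "lin f"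
    and f: "\<And>\<mu> v. \<mu> \<in> weight_lattice D \<Longrightarrow> v \<in> wsp \<mu> \<Longrightarrow> v \<in> L D \<Lambda> \<Longrightarrow> f v \<in> L D \<Lambda>"
    and v: "v \<in> L D \<Lambda>"
  shows "f v \<in> L D \<Lambda>"
proof (rule L_induct[OF \<Lambda> _ _ v])
  show "V.subspace {v. f v \<in> L D \<Lambda>}"
    using subspace_L[OF \<Lambda>]
    by (auto intro!: V.subspaceI
        simp: VV.linear_add[OF lin] VV.linear_scale[OF lin] VV.linear_0[OF lin]
          V.subspace_0 V.subspace_add V.subspace_scale)
qed (rule f)

lemma torus_elt_one: "torus_elt D x 1 = id"
  by (rule lin_eq_on_weights) (simp_all add: torus_elt_diagonal V.linear_id)

lemma torus_elt_inverse:
  assumes s: "s \<noteq> 0"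
  shows "bij (torus_elt D x s) \<and> inv (torus_elt D x s) = torus_elt D x (inverse s)"
proof -
  have *: "torus_elt D x a \<circ> torus_elt D x b = id" if "a * b = 1" for a b
  proof (rule lin_eq_on_weights)
    show "lin (torus_elt D x a \<circ> torus_elt D x b)" by (intro lin_compose torus_elt_diagonal(1))
    show "(torus_elt D x a \<circ> torus_elt D x b) v = id v" if "\<mu> \<in> weight_lattice D" "v \<in> wsp \<mu>" for \<mu> v
    proof -
      have "a powi \<mu> x * b powi \<mu> x = 1"
        unfolding power_int_mult_distrib[symmetric] \<open>a * b = 1\<close> by simp
      then show ?thesis
        by (simp add: torus_elt_diagonal(2)[OF that] VV.linear_scale[OF torus_elt_diagonal(1)] mult.commute)
    qed
  qed (rule V.linear_id)
  have "torus_elt D x s \<circ> torus_elt D x (inverse s) = id" "torus_elt D x (inverse s) \<circ> torus_elt D x s = id"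
    using s by (simp_all add: *)
  then show ?thesis using o_bij inv_unique_comp by blast
qed

section \<open>The monoid preserves each highest weight module\<close>

lemma G_hat_lin_L:
  assumes "g \<in> G_hat D"
  shows "lin g \<and> (\<forall>\<Lambda>\<in>dominant_weights D. \<forall>v\<in>L D \<Lambda>. g v \<in> L D \<Lambda>)"
  using assms unfolding G_hat_def
proof (induction rule: monoid_gen.induct)
  case 1
  show ?case using V.linear_id by (simp add: id_def)
next
  case (2 g)
  then consider x s where "g = torus_elt D x s" | \<beta> x where "\<beta> \<in> real_roots D" "x \<in> root_space D \<beta>" "g = exp_op D x"
    | R where "g = face_idem D R"
    by (auto simp: torus_gens_def root_gens_def)
  then show ?case
  proof cases
    case (1 x s)
    have "torus_elt D x s v \<in> L D \<Lambda>" if "\<Lambda> \<in> dominant_weights D" "v \<in> L D \<Lambda>" for \<Lambda> v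
      using torus_elt_diagonal(2)[of _ _ x s] V.subspace_scale[OF subspace_L[OF that(1)]]
      by (intro lin_maps_L[OF that(1) torus_elt_diagonal(1) _ that(2)]) simp
    then show ?thesis using 1 torus_elt_diagonal(1) by simp
  next
    case (2 \<beta> x)
    have "locally_nilpotent x" using real_root_nilpotent_on[OF 2(1,2)] by (simp add: locally_nilpotent_def)
    then show ?thesis using 2(3) exp_op_lin exp_op_L by simp
  next
    case (3 R)
    have "face_idem D R v \<in> L D \<Lambda>" if "\<Lambda> \<in> dominant_weights D" "v \<in> L D \<Lambda>" for \<Lambda> v
      using face_idem_diagonal(2)[of _ _ R] V.subspace_0[OF subspace_L[OF that(1)]]
      by (intro lin_maps_L[OF that(1) face_idem_diagonal(1) _ that(2)]) simp
    then show ?thesis using 3 face_idem_diagonal(1) by simp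
  qed
next
  case (3 x y)
  then show ?case using lin_compose[of x y] by (simp add: o_def)
qed

lemma real_root_locally_nilpotent: "\<beta> \<in> real_roots D \<Longrightarrow> x \<in> root_space D \<beta> \<Longrightarrow> locally_nilpotent x"
  using real_root_nilpotent_on by (simp add: locally_nilpotent_def)

lemma torus_gens_inverse:
  assumes "g \<in> torus_gens D"
  shows "bij g \<and> inv g \<in> torus_gens D"
proof -
  obtain x s where g: "g = torus_elt D x s" "s \<noteq> 0" using assms by (auto simp: torus_gens_def)
  have "torus_elt D x (inverse s) \<in> torus_gens D"
    unfolding torus_gens_def using g(2) nonzero_imp_inverse_nonzero by blast
  then show ?thesis using torus_elt_inverse[OF g(2), of x] by (simp add: g(1))
qed

lemma root_gens_inverse:
  assumes "\<Phi> \<subseteq> real_roots D" "g \<in> root_gens D \<Phi>"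
  shows "bij g \<and> inv g \<in> root_gens D \<Phi>"
proof -
  obtain \<beta> x where g: "\<beta> \<in> \<Phi>" "x \<in> root_space D \<beta>" "g = exp_op D x"
    using assms(2) by (auto simp: root_gens_def)
  have "locally_nilpotent x" by (rule real_root_locally_nilpotent[OF subsetD[OF assms(1) g(1)] g(2)])
  then have "bij g \<and> inv g = exp_op D (- x)" unfolding g(3) by (rule exp_op_inverse)
  moreover have "exp_op D (- x) \<in> root_gens D \<Phi>"
    unfolding root_gens_def using g(1) root_space_uminus[OF g(2)] by blast
  ultimately show ?thesis by simp
qed

lemma pos_real_roots_subset: "pos_real_roots D \<subseteq> real_roots D"
  and neg_real_roots_subset: "neg_real_roots D \<subseteq> real_roots D"
  by (auto simp: pos_real_roots_def neg_real_roots_def)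

text \<open>Representatives of Weyl group elements are built with inverses, which the monoid as a whole lacks. The
units form a group containing the generators of \<open>T\<close> and \<open>U\<^sup>\<plusminus>\<close> and the elements \<open>n\<^sub>i\<close>.\<close>

definition G_hat_units :: "('v \<Rightarrow> 'v) set" where
  "G_hat_units = {g. bij g \<and> g \<in> G_hat D \<and> inv g \<in> G_hat D}"

lemma G_hat_comp: "f \<in> G_hat D \<Longrightarrow> g \<in> G_hat D \<Longrightarrow> f \<circ> g \<in> G_hat D"
  unfolding G_hat_def by (rule monoid_gen.intros(3))

lemma torus_gens_G_hat: "g \<in> torus_gens D \<Longrightarrow> g \<in> G_hat D"
  and root_gens_G_hat: "\<Phi> \<subseteq> real_roots D \<Longrightarrow> g \<in> root_gens D \<Phi> \<Longrightarrow> g \<in> G_hat D"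
  and face_idem_G_hat: "R \<in> tits_faces D \<Longrightarrow> face_idem D R \<in> G_hat D"
  unfolding G_hat_def by (auto simp: root_gens_def intro!: monoid_gen.intros(2))

lemma group_gen_G_hat_units:
  assumes "S \<subseteq> G_hat_units" "g \<in> group_gen S"
  shows "g \<in> G_hat_units"
  using group_gen_subset_units[of S, OF _ assms(2)] assms(1)
  unfolding G_hat_units_def G_hat_def by blast

lemma torus_gens_units: "torus_gens D \<subseteq> G_hat_units"
  using torus_gens_inverse torus_gens_G_hat by (auto simp: G_hat_units_def)

lemma root_gens_units: "\<Phi> \<subseteq> real_roots D \<Longrightarrow> root_gens D \<Phi> \<subseteq> G_hat_units"
  using root_gens_inverse root_gens_G_hat by (auto simp: G_hat_units_def)

lemma torus_units: "torus D \<subseteq> G_hat_units"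
  unfolding torus_def using group_gen_G_hat_units[OF torus_gens_units] by blast

lemma U_units: "U_pos D \<subseteq> G_hat_units" "U_neg D \<subseteq> G_hat_units"
  unfolding U_pos_def U_neg_def
  using group_gen_G_hat_units[OF root_gens_units] pos_real_roots_subset neg_real_roots_subset by blast+

lemma G_hat_units_comp: "f \<in> G_hat_units \<Longrightarrow> g \<in> G_hat_units \<Longrightarrow> f \<circ> g \<in> G_hat_units"
  unfolding G_hat_units_def using o_inv_distrib[of f g] by (auto intro: bij_comp G_hat_comp)

lemma simple_root_real: "\<alpha> i \<in> real_roots D" "(\<lambda>h. - \<alpha> i h) \<in> real_roots D"
proof -
  have "id \<in> weyl_group D" unfolding weyl_group_def by (rule group_gen.intros(1))
  then show "\<alpha> i \<in> real_roots D" 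
    unfolding real_roots_def mem_Collect_eq by (intro bexI[of _ id] exI[of _ i]) simp_all
  have "reflection D i \<in> weyl_group D" unfolding weyl_group_def by (rule group_gen.intros(2)) simp
  moreover have "to_real (\<lambda>h. - \<alpha> i h) = reflection D i (to_real (\<alpha> i))"
    by (simp add: reflection_apply to_real_def simple_root_coroot)
  ultimately show "(\<lambda>h. - \<alpha> i h) \<in> real_roots D" unfolding real_roots_def by blast
qed

lemma n_elt_units: "n_elt D i \<in> G_hat_units"
proof -
  have e: "exp_op D (chev_e D i) \<in> G_hat_units"
    using root_gens_units[of "{\<alpha> i}"] simple_root_real chev_e_root by (auto simp: root_gens_def)
  have f: "exp_op D (- chev_f D i) \<in> G_hat_units"
    using root_gens_units[of "{\<lambda>h. - \<alpha> i h}"] simple_root_real root_space_uminus[OF chev_f_root]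
    by (auto simp: root_gens_def)
  show ?thesis unfolding n_elt_def by (intro G_hat_units_comp e f)
qed

lemma N_graph_units: "(n, \<sigma>) \<in> N_graph D \<Longrightarrow> n \<in> G_hat_units"
proof (induction rule: N_graph.induct)
  case (1 t)
  then show ?case using torus_units by blast
next
  case (4 n \<sigma>)
  then show ?case by (simp add: G_hat_units_def bij_imp_bij_inv inv_inv_eq)
qed (rule n_elt_units G_hat_units_comp; assumption)+

lemma represents_G_hat:
  assumes "represents D n w"
  shows "n \<in> G_hat D"
proof -
  obtain \<sigma> R n\<^sub>\<sigma> t where *: "R \<in> tits_faces D" "t \<in> torus D" "(n\<^sub>\<sigma>, \<sigma>) \<in> N_graph D"
    "n = n\<^sub>\<sigma> \<circ> face_idem D R \<circ> t"
    using assms unfolding represents_def by blast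
  have "n\<^sub>\<sigma> \<in> G_hat D" using N_graph_units[OF *(3)] by (simp add: G_hat_units_def)
  moreover have "t \<in> G_hat D" using torus_units *(2) by (auto simp: G_hat_units_def)
  ultimately show ?thesis unfolding *(4) by (intro G_hat_comp face_idem_G_hat *(1))
qed

section \<open>Rational curves of operators\<close>

text \<open>The coefficients of \<open>\<phi> s w\<close> are required to lie in the same \<open>L(\<Lambda>)\<close> as \<open>w\<close>, since the contravariant
form is linear only there.\<close>

definition curve :: "'k set \<Rightarrow> ('k \<Rightarrow> 'v \<Rightarrow> 'v) \<Rightarrow> bool" where
  "curve S \<phi> \<longleftrightarrow> (\<forall>s. s \<notin> S \<longrightarrow> lin (\<phi> s)) \<and>
     (\<forall>\<Lambda>\<in>dominant_weights D. \<forall>w\<in>L D \<Lambda>. regular_vec (vscale D) S (L D \<Lambda>) (\<lambda>s. \<phi> s w))"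

lemma curve_const:
  assumes "g \<in> G_hat D"
  shows "curve S (\<lambda>s. g)"
  using G_hat_lin_L[OF assms] V.regular_vec_const unfolding curve_def by simp

lemma curve_mono:
  assumes \<phi>: "curve S \<phi>" and S: "S \<subseteq> S'"
  shows "curve S' \<phi>"
  unfolding curve_def
proof (intro conjI allI impI ballI)
  fix s assume "s \<notin> S'"
  then show "lin (\<phi> s)" using \<phi> S by (auto simp: curve_def)
next
  fix \<Lambda> w assume "\<Lambda> \<in> dominant_weights D" "w \<in> L D \<Lambda>"
  then have "regular_vec (vscale D) S (L D \<Lambda>) (\<lambda>s. \<phi> s w)" using \<phi> by (simp add: curve_def)
  then show "regular_vec (vscale D) S' (L D \<Lambda>) (\<lambda>s. \<phi> s w)" using S by (rule V.regular_vec_mono)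
qed

text \<open>Linearity of \<open>\<phi> s\<close> lets a curve act on a moving vector coefficient by coefficient; closure of curves under
composition is an immediate consequence.\<close>

lemma curve_regular_vec:
  assumes \<phi>: "curve S \<phi>" and \<Lambda>: "\<Lambda> \<in> dominant_weights D"
    and F: "regular_vec (vscale D) S (L D \<Lambda>) F"
  shows "regular_vec (vscale D) S (L D \<Lambda>) (\<lambda>s. \<phi> s (F s))"
proof -
  have lin: "lin (\<phi> s)" if "s \<notin> S" for s using \<phi> that by (simp add: curve_def)
  show ?thesis
    using F
  proof (induction rule: regular_vec.induct)
    case (single f v F)
    have "regular_vec (vscale D) S (L D \<Lambda>) (\<lambda>s. vscale D (f s) (\<phi> s v))"
      using \<phi> \<Lambda> single(2) by (intro V.regular_vec_scale single(1)) (simp add: curve_def)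
    then show ?case
      by (rule V.regular_vec_cong) (simp add: single(3) VV.linear_scale[OF lin])
  next
    case (add F G H)
    show ?case
      by (rule regular_vec.add[OF add.IH]) (simp add: add(3) VV.linear_add[OF lin])
  qed
qed

lemma curve_comp:
  assumes "curve S \<phi>" "curve S \<psi>"
  shows "curve S (\<lambda>s. \<phi> s \<circ> \<psi> s)"
  unfolding curve_def
proof (intro conjI allI impI ballI)
  fix s assume "s \<notin> S"
  then show "lin (\<phi> s \<circ> \<psi> s)" using assms by (intro lin_compose) (auto simp: curve_def)
next
  fix \<Lambda> w assume \<Lambda>: "\<Lambda> \<in> dominant_weights D" and w: "w \<in> L D \<Lambda>"
  have "regular_vec (vscale D) S (L D \<Lambda>) (\<lambda>s. \<psi> s w)"
    using assms(2) \<Lambda> w by (simp add: curve_def)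
  then show "regular_vec (vscale D) S (L D \<Lambda>) (\<lambda>s. (\<phi> s \<circ> \<psi> s) w)"
    using curve_regular_vec[OF assms(1) \<Lambda>] by simp
qed

text \<open>The finite set \<open>S\<close> absorbs the parameters at which an interpolated torus element would degenerate; the
endpoints have to stay outside it.\<close>

definition joined :: "('v \<Rightarrow> 'v) set \<Rightarrow> ('v \<Rightarrow> 'v) \<Rightarrow> ('v \<Rightarrow> 'v) \<Rightarrow> bool" where
  "joined M g h \<longleftrightarrow> (\<exists>S \<phi>. finite S \<and> 0 \<notin> S \<and> 1 \<notin> S \<and> curve S \<phi> \<and>
     (\<forall>s. s \<notin> S \<longrightarrow> \<phi> s \<in> M) \<and> \<phi> 0 = g \<and> \<phi> 1 = h)"

lemma joined_comp:
  assumes "joined M g h" "joined M' g' h'"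
    and MM: "\<And>a b. a \<in> M \<Longrightarrow> b \<in> M' \<Longrightarrow> a \<circ> b \<in> M''"
  shows "joined M'' (g \<circ> g') (h \<circ> h')"
proof -
  obtain S \<phi> where S: "finite S" "0 \<notin> S" "1 \<notin> S" "curve S \<phi>" "\<forall>s. s \<notin> S \<longrightarrow> \<phi> s \<in> M" "\<phi> 0 = g" "\<phi> 1 = h"
    using assms(1) unfolding joined_def by blast
  obtain T \<psi> where T: "finite T" "0 \<notin> T" "1 \<notin> T" "curve T \<psi>" "\<forall>s. s \<notin> T \<longrightarrow> \<psi> s \<in> M'" "\<psi> 0 = g'" "\<psi> 1 = h'"
    using assms(2) unfolding joined_def by blast
  have "curve (S \<union> T) (\<lambda>s. \<phi> s \<circ> \<psi> s)"
    by (intro curve_comp curve_mono[OF S(4)] curve_mono[OF T(4)]) auto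
  then show ?thesis unfolding joined_def
    using S T MM by (intro exI[of _ "S \<union> T"] exI[of _ "\<lambda>s. \<phi> s \<circ> \<psi> s"]) simp
qed

lemma joined_refl: "g \<in> M \<Longrightarrow> g \<in> G_hat D \<Longrightarrow> joined M g g"
  unfolding joined_def by (intro exI[of _ "{}"] exI[of _ "\<lambda>s. g"]) (simp add: curve_const)

definition rationally_connected :: "('v \<Rightarrow> 'v) set \<Rightarrow> bool" where
  "rationally_connected M \<longleftrightarrow> (\<forall>g\<in>M. \<forall>h\<in>M. joined M g h)"

lemma rationally_connected_comp:
  assumes "rationally_connected A" "rationally_connected B"
  shows "rationally_connected {a \<circ> b | a b. a \<in> A \<and> b \<in> B}"
proof -
  have "joined {a \<circ> b | a b. a \<in> A \<and> b \<in> B} (a \<circ> b) (a' \<circ> b')"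
    if "a \<in> A" "b \<in> B" "a' \<in> A" "b' \<in> B" for a b a' b'
    by (rule joined_comp[of A _ _ B]) (use assms that in \<open>auto simp: rationally_connected_def\<close>)
  then show ?thesis unfolding rationally_connected_def by auto
qed

lemma G_hat_id: "id \<in> G_hat D"
  unfolding G_hat_def by (rule monoid_gen.intros(1))

text \<open>Curves from the factors to the identity multiply to curves from a product to the identity. Two arbitrary
elements \<open>g = g \<cdot> 1\<close> and \<open>h = 1 \<cdot> h\<close> are joined by the product of a curve from \<open>g\<close> to \<open>1\<close> and one from
\<open>1\<close> to \<open>h\<close>.\<close>

lemma rationally_connected_monoid_gen:
  assumes S: "\<And>g. g \<in> S \<Longrightarrow> joined (monoid_gen S) g id \<and> joined (monoid_gen S) id g"
  shows "rationally_connected (monoid_gen S)"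
proof -
  have comp: "joined (monoid_gen S) (g \<circ> g') (h \<circ> h')"
    if "joined (monoid_gen S) g h" "joined (monoid_gen S) g' h'" for g h g' h'
    by (rule joined_comp[OF that monoid_gen.intros(3)])
  have id: "joined (monoid_gen S) g id \<and> joined (monoid_gen S) id g" if "g \<in> monoid_gen S" for g
    using that
  proof (induction rule: monoid_gen.induct)
    case 1
    show ?case by (intro conjI joined_refl monoid_gen.intros(1) G_hat_id)
  next
    case (2 g)
    then show ?case by (rule S)
  next
    case (3 g h)
    then show ?case using comp[of g id h id] comp[of id g id h] unfolding comp_id by blast
  qed
  have "joined (monoid_gen S) (g \<circ> id) (id \<circ> h)" if "g \<in> monoid_gen S" "h \<in> monoid_gen S" for g h
    using comp id that by blast
  then show ?thesis unfolding rationally_connected_def comp_id id_comp by blast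
qed

lemma curve_by_weights:
  assumes lin: "\<And>s. s \<notin> S \<Longrightarrow> lin (\<phi> s)"
    and reg: "\<And>\<Lambda> \<mu> v. \<Lambda> \<in> dominant_weights D \<Longrightarrow> v \<in> L D \<Lambda> \<Longrightarrow> \<mu> \<in> weight_lattice D \<Longrightarrow> v \<in> wsp \<mu> \<Longrightarrow>
      regular_vec (vscale D) S (L D \<Lambda>) (\<lambda>s. \<phi> s v)"
  shows "curve S \<phi>"
  unfolding curve_def
proof (intro conjI allI impI ballI lin)
  fix \<Lambda> w assume \<Lambda>: "\<Lambda> \<in> dominant_weights D" and w: "w \<in> L D \<Lambda>"
  show "regular_vec (vscale D) S (L D \<Lambda>) (\<lambda>s. \<phi> s w)"
  proof (rule L_induct[OF \<Lambda> _ reg[OF \<Lambda>] w])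
    show "V.subspace {v. regular_vec (vscale D) S (L D \<Lambda>) (\<lambda>s. \<phi> s v)}"
    proof (rule V.subspaceI; clarsimp)
      show "regular_vec (vscale D) S (L D \<Lambda>) (\<lambda>s. \<phi> s 0)"
        by (rule V.regular_vec_cong[OF V.regular_vec_const[OF V.subspace_0[OF subspace_L[OF \<Lambda>]]]])
          (simp add: VV.linear_0[OF lin])
    next
      fix u v assume "regular_vec (vscale D) S (L D \<Lambda>) (\<lambda>s. \<phi> s u)" "regular_vec (vscale D) S (L D \<Lambda>) (\<lambda>s. \<phi> s v)"
      then show "regular_vec (vscale D) S (L D \<Lambda>) (\<lambda>s. \<phi> s (u + v))"
        by (rule regular_vec.add) (simp add: VV.linear_add[OF lin])
    next
      fix c v assume "regular_vec (vscale D) S (L D \<Lambda>) (\<lambda>s. \<phi> s v)"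
      then have "regular_vec (vscale D) S (L D \<Lambda>) (\<lambda>s. vscale D c (\<phi> s v))"
        by (rule V.regular_vec_scale) (rule regular_const)
      then show "regular_vec (vscale D) S (L D \<Lambda>) (\<lambda>s. \<phi> s (vscale D c v))"
        by (rule V.regular_vec_cong) (simp add: VV.linear_scale[OF lin])
    qed
  qed
qed

lemma joined_torus_elt:
  assumes "a \<noteq> 0" "b \<noteq> 0" and M: "\<And>s. s \<noteq> 0 \<Longrightarrow> torus_elt D x s \<in> M"
  shows "joined M (torus_elt D x a) (torus_elt D x b)"
proof -
  \<comment> \<open>The parameter moves linearly from \<open>a\<close> to \<open>b\<close>; its zero is excluded, and it is
    neither at \<open>0\<close> nor at \<open>1\<close>.\<close>
  let ?p = "[:a, b - a:]"
  let ?S = "{s. poly ?p s = 0}"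
  have "curve ?S (\<lambda>s. torus_elt D x (poly ?p s))"
  proof (rule curve_by_weights[OF torus_elt_diagonal(1)])
    fix \<Lambda> \<mu> v assume "v \<in> L D \<Lambda>" and \<mu>: "\<mu> \<in> weight_lattice D" and v: "v \<in> wsp \<mu>"
    then show "regular_vec (vscale D) ?S (L D \<Lambda>) (\<lambda>s. torus_elt D x (poly ?p s) v)"
      by (intro regular_vec.single[OF regular_powi[of ?S ?p "\<mu> x"]])
        (simp_all only: torus_elt_diagonal(2)[OF \<mu> v] mem_Collect_eq not_False_eq_True simp_thms)
  qed
  moreover have "finite ?S" by (rule poly_roots_finite) (use assms(1) in simp)
  ultimately show ?thesis unfolding joined_def
    using assms by (intro exI[of _ ?S] exI[of _ "\<lambda>s. torus_elt D x (poly ?p s)"]) (simp del: poly_pCons, simp)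
qed

lemma joined_exp_op:
  assumes x: "locally_nilpotent x" and M: "\<And>c. exp_op D (gscale D c x) \<in> M"
  shows "joined M (exp_op D (gscale D a x)) (exp_op D (gscale D b x))"
proof -
  let ?p = "[:a, b - a:]"
  have "curve {} (\<lambda>s. exp_op D (gscale D (poly ?p s) x))"
  proof (rule curve_by_weights[OF exp_op_lin[OF locally_nilpotent_gscale[OF x]]])
    fix \<Lambda> \<mu> v assume \<Lambda>: "\<Lambda> \<in> dominant_weights D" and v: "v \<in> L D \<Lambda>"
    obtain n where n: "(act D x ^^ n) v = 0" by (rule locally_nilpotentE[OF x])
    have "regular_vec (vscale D) {} (L D \<Lambda>)
        (\<lambda>s. \<Sum>k<n. vscale D (poly (smult (1 / fact k) (?p ^ k)) s) ((act D x ^^ k) v))"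
      by (intro V.regular_vec_sum V.regular_vec_scale V.regular_vec_const regular_poly subspace_L \<Lambda>
          act_pow_L v) simp
    then show "regular_vec (vscale D) {} (L D \<Lambda>) (\<lambda>s. exp_op D (gscale D (poly ?p s) x) v)"
      by (rule V.regular_vec_cong) (simp add: exp_op_gscale[OF n] poly_power)
  qed
  then show ?thesis unfolding joined_def
    using M by (intro exI[of _ "{}"] exI[of _ "\<lambda>s. exp_op D (gscale D (poly ?p s) x)"]) simp
qed

lemma torus_connected: "rationally_connected (torus D)"
proof -
  have "torus D = monoid_gen (torus_gens D)"
    unfolding torus_def by (rule group_gen_eq_monoid_gen[OF torus_gens_inverse])
  moreover have "rationally_connected (monoid_gen (torus_gens D))"
  proof (rule rationally_connected_monoid_gen)
    fix g assume "g \<in> torus_gens D"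
    then obtain x s where g: "g = torus_elt D x s" "s \<noteq> 0" by (auto simp: torus_gens_def)
    have M: "torus_elt D x r \<in> monoid_gen (torus_gens D)" if "r \<noteq> 0" for r
      using that by (intro monoid_gen.intros(2)) (auto simp: torus_gens_def)
    show "joined (monoid_gen (torus_gens D)) g id \<and> joined (monoid_gen (torus_gens D)) id g"
      using joined_torus_elt[OF g(2) one_neq_zero M] joined_torus_elt[OF one_neq_zero g(2) M]
      by (simp add: g(1) torus_elt_one)
  qed
  ultimately show ?thesis by simp
qed

lemma exp_op_zero: "exp_op D 0 = id"
  using exp_op_eq[of 1 0] by (simp add: fun_eq_iff act_left_zero)

lemma root_group_connected:
  assumes \<Phi>: "\<Phi> \<subseteq> real_roots D"
  shows "rationally_connected (group_gen (root_gens D \<Phi>))"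
proof -
  have "group_gen (root_gens D \<Phi>) = monoid_gen (root_gens D \<Phi>)"
    by (rule group_gen_eq_monoid_gen[OF root_gens_inverse[OF \<Phi>]])
  moreover have "rationally_connected (monoid_gen (root_gens D \<Phi>))"
  proof (rule rationally_connected_monoid_gen)
    fix g assume "g \<in> root_gens D \<Phi>"
    then obtain \<beta> x where g: "\<beta> \<in> \<Phi>" "x \<in> root_space D \<beta>" "g = exp_op D x"
      by (auto simp: root_gens_def)
    have x: "locally_nilpotent x" by (rule real_root_locally_nilpotent[OF subsetD[OF \<Phi> g(1)] g(2)])
    have M: "exp_op D (gscale D c x) \<in> monoid_gen (root_gens D \<Phi>)" for c
      using g(1) root_space_gscale[OF g(2)] by (intro monoid_gen.intros(2)) (auto simp: root_gens_def)
    show "joined (monoid_gen (root_gens D \<Phi>)) g id \<and> joined (monoid_gen (root_gens D \<Phi>)) id g"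
      using joined_exp_op[OF x M, of 0 1] joined_exp_op[OF x M, of 1 0]
      by (simp add: g(3) exp_op_zero)
  qed
  ultimately show ?thesis by simp
qed

lemma B_connected: "rationally_connected (B_pos D)" "rationally_connected (B_neg D)"
  unfolding B_pos_def B_neg_def U_pos_def U_neg_def
  by (intro rationally_connected_comp torus_connected root_group_connected
      pos_real_roots_subset neg_real_roots_subset)+

lemma double_coset_connected:
  assumes "rationally_connected B1" "rationally_connected B2" "n \<in> G_hat D"
  shows "rationally_connected (double_coset B1 n B2)"
proof -
  have "rationally_connected {n}"
    using assms(3) by (simp add: rationally_connected_def joined_refl)
  then have "rationally_connected {x \<circ> b' | x b'. x \<in> {b \<circ> m | b m. b \<in> B1 \<and> m \<in> {n}} \<and> b' \<in> B2}"
    by (intro rationally_connected_comp assms)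
  moreover have "{x \<circ> b' | x b'. x \<in> {b \<circ> m | b m. b \<in> B1 \<and> m \<in> {n}} \<and> b' \<in> B2} = double_coset B1 n B2"
    unfolding double_coset_def by blast
  ultimately show ?thesis by simp
qed

section \<open>Irreducibility\<close>

lemma coord_ring_regular:
  assumes f: "f \<in> coord_ring D" and \<phi>: "curve S \<phi>"
  shows "regular S (\<lambda>s. f (\<phi> s))"
proof -
  interpret F: module "\<lambda>c (f :: ('v \<Rightarrow> 'v) \<Rightarrow> 'k) x. c * f x"
    by standard (auto simp: fun_eq_iff algebra_simps)
  show ?thesis
    using f unfolding coord_ring_def
  proof (induction rule: F.span_induct_alt)
    case base
    show ?case by (simp add: regular_const)
  next
    case (step c m g)
    then obtain \<Lambda> v w where m: "m = matrix_coeff D \<Lambda> v w" and \<Lambda>: "\<Lambda> \<in> dominant_weights D"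
      and v: "v \<in> L D \<Lambda>" and w: "w \<in> L D \<Lambda>" by blast
    have "regular_vec (vscale D) S (L D \<Lambda>) (\<lambda>s. \<phi> s w)"
      using \<phi> \<Lambda> w by (simp add: curve_def)
    then have "regular S (\<lambda>s. form D \<Lambda> v (\<phi> s w))"
      by (rule V.regular_vec_functional[OF _ subspace_L[OF \<Lambda>]])
        (simp_all add: form_add[OF \<Lambda>] form_scale[OF \<Lambda>] v)
    then have "regular S (\<lambda>s. m (\<phi> s))" by (simp add: m matrix_coeff_def)
    then have "regular S (\<lambda>s. c * m (\<phi> s) + g (\<phi> s))"
      by (intro regular_add regular_mult regular_const step)
    then show ?case by simp
  qed
qed

text \<open>A point of the curve at which both separating functions are nonzero contradicts the covering by the two
closed sets.\<close>

lemma zariski_irreducibleI: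
  assumes "rationally_connected Y" "Y \<subseteq> G_hat D" "Y \<noteq> {}"
  shows "zariski_irreducible D Y"
  unfolding zariski_irreducible_def
proof (intro conjI allI impI assms)
  fix C1 C2 assume C: "zariski_closed D C1 \<and> zariski_closed D C2 \<and> Y = (Y \<inter> C1) \<union> (Y \<inter> C2)"
  have sep: "\<exists>y f. y \<in> Y \<and> f \<in> coord_ring D \<and> f y \<noteq> 0 \<and> (\<forall>x\<in>C. f x = 0)"
    if closed: "zariski_closed D C" and proper: "Y \<inter> C \<noteq> Y" for C
  proof -
    have "\<exists>F. F \<subseteq> coord_ring D \<and> C = {x \<in> G_hat D. \<forall>f\<in>F. f x = 0}"
      using closed unfolding zariski_closed_def .
    then obtain F where F: "F \<subseteq> coord_ring D \<and> C = {x \<in> G_hat D. \<forall>f\<in>F. f x = 0}" ..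
    obtain y where y: "y \<in> Y" "y \<notin> C" using proper by auto
    have "y \<in> G_hat D" using y(1) assms(2) by (rule rev_subsetD)
    then have "\<not> (\<forall>f\<in>F. f y = 0)" using y(2) F by simp
    then obtain f where f: "f \<in> F" "f y \<noteq> 0" by auto
    have "f \<in> coord_ring D" using F f(1) by auto
    moreover have "\<forall>x\<in>C. f x = 0" using F f(1) by simp
    ultimately show ?thesis using y(1) f(2) by (intro exI[of _ y] exI[of _ f]) simp
  qed
  show "Y \<inter> C1 = Y \<or> Y \<inter> C2 = Y"
  proof (rule ccontr)
    assume "\<not> ?thesis"
    then have ne: "Y \<inter> C1 \<noteq> Y" "Y \<inter> C2 \<noteq> Y" by simp_all
    obtain y1 f1 where y1: "y1 \<in> Y" "f1 \<in> coord_ring D" "f1 y1 \<noteq> 0" "\<forall>x\<in>C1. f1 x = 0"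
      using sep[OF conjunct1[OF C] ne(1)] by auto
    obtain y2 f2 where y2: "y2 \<in> Y" "f2 \<in> coord_ring D" "f2 y2 \<noteq> 0" "\<forall>x\<in>C2. f2 x = 0"
      using sep[OF conjunct1[OF conjunct2[OF C]] ne(2)] by auto
    have "joined Y y1 y2" using assms(1) y1(1) y2(1) by (simp add: rationally_connected_def)
    then obtain S \<phi> where S: "finite S" "0 \<notin> S" "1 \<notin> S" "curve S \<phi>" "\<forall>s. s \<notin> S \<longrightarrow> \<phi> s \<in> Y"
      "\<phi> 0 = y1" "\<phi> 1 = y2"
      unfolding joined_def by blast
    obtain s where s: "s \<notin> S" "f1 (\<phi> s) \<noteq> 0" "f2 (\<phi> s) \<noteq> 0"
      by (rule regular_common_nonzero[OF S(1) coord_ring_regular[OF y1(2) S(4)] S(2) _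
            coord_ring_regular[OF y2(2) S(4)] S(3)])
        (use S(6,7) y1(3) y2(3) in auto)
    have "\<phi> s \<in> Y" using S(5) s(1) by blast
    then have "\<phi> s \<in> C1 \<or> \<phi> s \<in> C2" using C by blast
    then show False using s y1(4) y2(4) by blast
  qed
qed

lemma double_coset_irreducible:
  assumes "rationally_connected B1" "rationally_connected B2" "n \<in> G_hat D"
    and "B1 \<subseteq> G_hat D" "B2 \<subseteq> G_hat D" "B1 \<noteq> {}" "B2 \<noteq> {}"
  shows "zariski_irreducible D (double_coset B1 n B2)"
proof (rule zariski_irreducibleI)
  show "double_coset B1 n B2 \<subseteq> G_hat D"
    unfolding double_coset_def using assms by (auto intro!: G_hat_comp)
  show "double_coset B1 n B2 \<noteq> {}" unfolding double_coset_def using assms(6,7) by auto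
qed (rule double_coset_connected[OF assms(1-3)])

lemma B_G_hat: "B_pos D \<subseteq> G_hat D" "B_neg D \<subseteq> G_hat D"
  unfolding B_pos_def B_neg_def using torus_units U_units
  by (auto simp: G_hat_units_def intro!: G_hat_comp)

lemma B_nonempty: "B_pos D \<noteq> {}" "B_neg D \<noteq> {}"
  unfolding B_pos_def B_neg_def torus_def U_pos_def U_neg_def
  using group_gen.intros(1) by blast+

end

theorem corollary2p11:
  fixes D :: "('k::field_char_0, 'n::finite, 'h::ab_group_add, 'g::ab_group_add, 'v::ab_group_add) km_data"
  assumes "kac_moody_setting D"
  shows "\<forall>w\<in>weyl_monoid D. \<forall>n. represents D n w \<longrightarrow>
           zariski_irreducible D (double_coset (B_pos D) n (B_pos D)) \<and>
           zariski_irreducible D (double_coset (B_neg D) n (B_neg D)) \<and>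
           zariski_irreducible D (double_coset (B_neg D) n (B_pos D))"
proof -
  interpret kac_moody D by standard (rule assms)
  show ?thesis
    by (intro ballI allI impI conjI double_coset_irreducible B_connected represents_G_hat B_G_hat B_nonempty)
qed

end
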